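(* Let $G$ be an $X$-generated group. Then $M_{sF}(G,X)\cong S_\circ$.
   Context: Cayley graph: $\overline X=X\cup X^{-1}$; a group $G$ is $X$-generated if it comes with a (not necessarily injective) map $X\to G$ whose image generates $G$; $[x]$ is the element represented by $x\in\overline X$. $\mathrm{Cay}(G,X)$ has vertex set $G$ and, for each $g\in G$, $x\in\overline X$, an edge labelled $x$ from $g$ to $g[x]$; its inverse is the edge labelled $x^{-1}$ from $g[x]$ to $g$. A subgraph is a set of vertices and edges closed under endpoints and inversion of edges; $G$ acts on subgraphs by left multiplication. A path is simple if all its vertices are distinct (the empty path at a vertex is simple); a simple cycle is a path ending at its initial vertex such that the initial vertices of all its edges are distinct. The subgraph spanned by a path consists of its edges, their inverses, and all vertices visited. Margolis–Meakin expansion: $M(G,X)$ is the inverse monoid of pairs $(\Gamma,g)$ with $\Gamma$ a finite connected subgraph of $\mathrm{Cay}(G,X)$ containing $1$ and $g$, with $(\Delta,g)(\Xi,h)=(\Delta\cup g\Xi,gh)$ and $(\Delta,g)^{-1}=(g^{-1}\Delta,g^{-1})$; it is $X$-generated via $x\mapsto(\Gamma_x,[x])$, where $\Gamma_x$ is the subgraph spanned by the edge labelled $x$ starting at $1$. Let $\xi_G$ be the congruence of $M(G,X)$ generated by all pairs $((\Pi_1,g),(\Pi_2,g))$ with $g\in G$ and $\Pi_1,\Pi_2$ subgraphs spanned by simple paths from $1$ to $g$, and put $M_{sF}(G,X)=M(G,X)/\xi_G$. The inverse monoid $S_\circ$: a subgraph $\Delta\subseteq\mathrm{Cay}(G,X)$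 is cyclic if for every edge $e$ of $\Delta$ it contains all edges of any simple cycle containing $e$. For any subgraph $\Delta$ there is a smallest cyclic subgraph $\Delta^\circ$ containing $\Delta$, the cyclic closure of $\Delta$. A subgraph is compact if it is of the form $F^\circ$ for a finite connected subgraph $F$. $S_\circ$ is the set of all pairs $(\Delta,g)$ with $g\in G$ and $\Delta$ a compact connected subgraph of $\mathrm{Cay}(G,X)$ containing $1$ and $g$, with operations $(\Delta,g)(\Xi,h)=((\Delta\cup g\Xi)^\circ,gh)$ and $(\Delta,g)^{-1}=(g^{-1}\Delta,g^{-1})$. This is an $X$-generated $E$-unitary inverse monoid with generators $(\Gamma_x^\circ,[x])$, $x\in X$. *)

theory Defs
  imports "HOL-Algebra.Generated_Groups"
begin

section \<open>Generated groups and their Cayley graphs\<close>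

text \<open>The map \<open>\<iota>\<close> from \<open>X\<close> to the group need not be injective.\<close>

locale X_generated_group = group G
  for G :: "('g, 'm) monoid_scheme" (structure) and X :: "'x set" and \<iota> :: "'x \<Rightarrow> 'g" +
  assumes gens_closed: "\<iota> \<in> X \<rightarrow> carrier G"
    and gens_generate: "generate G (\<iota> ` X) = carrier G"

text \<open>Letters of the doubled alphabet: \<open>Neg x\<close> is the formal inverse of \<open>x\<close>, hence always
  distinct from \<open>x\<close>, whatever the values in \<open>G\<close>.\<close>

datatype 'x letter = Pos 'x | Neg 'x

fun linv :: "'x letter \<Rightarrow> 'x letter" where
  "linv (Pos x) = Neg x"
| "linv (Neg x) = Pos x"

definition letters :: "'x set \<Rightarrow> 'x letter set" where
  "letters X = Pos ` X \<union> Neg ` X"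

fun lval :: "('g, 'm) monoid_scheme \<Rightarrow> ('x \<Rightarrow> 'g) \<Rightarrow> 'x letter \<Rightarrow> 'g" where
  "lval G \<iota> (Pos x) = \<iota> x"
| "lval G \<iota> (Neg x) = inv\<^bsub>G\<^esub> (\<iota> x)"

text \<open>The pair \<open>(g, a)\<close> encodes the edge labelled \<open>a\<close> from \<open>g\<close> to \<open>g[a]\<close>.\<close>

type_synonym ('g, 'x) edge = "'g \<times> 'x letter"

definition src :: "('g, 'x) edge \<Rightarrow> 'g" where
  "src e = fst e"

definition tgt :: "('g, 'm) monoid_scheme \<Rightarrow> ('x \<Rightarrow> 'g) \<Rightarrow> ('g, 'x) edge \<Rightarrow> 'g" where
  "tgt G \<iota> e = fst e \<otimes>\<^bsub>G\<^esub> lval G \<iota> (snd e)"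

definition einv :: "('g, 'm) monoid_scheme \<Rightarrow> ('x \<Rightarrow> 'g) \<Rightarrow> ('g, 'x) edge \<Rightarrow> ('g, 'x) edge" where
  "einv G \<iota> e = (tgt G \<iota> e, linv (snd e))"

record ('g, 'x) graph =
  verts :: "'g set"
  edges :: "('g, 'x) edge set"

definition Cay :: "('g, 'm) monoid_scheme \<Rightarrow> 'x set \<Rightarrow> ('g, 'x) graph" where
  "Cay G X = \<lparr>verts = carrier G, edges = carrier G \<times> letters X\<rparr>"

definition subgraph ::
  "('g, 'm) monoid_scheme \<Rightarrow> 'x set \<Rightarrow> ('x \<Rightarrow> 'g) \<Rightarrow> ('g, 'x) graph \<Rightarrow> bool" where
  "subgraph G X \<iota> \<Delta> \<longleftrightarrow>
     verts \<Delta> \<subseteq> verts (Cay G X) \<and> edges \<Delta> \<subseteq> edges (Cay G X) \<and>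
     (\<forall>e \<in> edges \<Delta>. src e \<in> verts \<Delta> \<and> tgt G \<iota> e \<in> verts \<Delta> \<and> einv G \<iota> e \<in> edges \<Delta>)"

definition finite_graph :: "('g, 'x) graph \<Rightarrow> bool" where
  "finite_graph \<Delta> \<longleftrightarrow> finite (verts \<Delta>) \<and> finite (edges \<Delta>)"

definition gle :: "('g, 'x) graph \<Rightarrow> ('g, 'x) graph \<Rightarrow> bool" where
  "gle \<Delta> \<Xi> \<longleftrightarrow> verts \<Delta> \<subseteq> verts \<Xi> \<and> edges \<Delta> \<subseteq> edges \<Xi>"

definition gunion :: "('g, 'x) graph \<Rightarrow> ('g, 'x) graph \<Rightarrow> ('g, 'x) graph" where
  "gunion \<Delta> \<Xi> = \<lparr>verts = verts \<Delta> \<union> verts \<Xi>, edges = edges \<Delta> \<union> edges \<Xi>\<rparr>"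

definition translate ::
  "('g, 'm) monoid_scheme \<Rightarrow> 'g \<Rightarrow> ('g, 'x) graph \<Rightarrow> ('g, 'x) graph" where
  "translate G g \<Delta> =
     \<lparr>verts = (\<lambda>h. g \<otimes>\<^bsub>G\<^esub> h) ` verts \<Delta>, edges = (\<lambda>(h, a). (g \<otimes>\<^bsub>G\<^esub> h, a)) ` edges \<Delta>\<rparr>"

text \<open>\<open>path_in G \<iota> \<Delta> g es h\<close>: the edge list \<open>es\<close> is a path in \<open>\<Delta>\<close> from \<open>g\<close> to \<open>h\<close>. The initial
  vertex is a separate argument so that there is an empty path at every vertex.\<close>

fun path_in ::
  "('g, 'm) monoid_scheme \<Rightarrow> ('x \<Rightarrow> 'g) \<Rightarrow> ('g, 'x) graph \<Rightarrow>
   'g \<Rightarrow> ('g, 'x) edge list \<Rightarrow> 'g \<Rightarrow> bool" where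
  "path_in G \<iota> \<Delta> g [] h \<longleftrightarrow> g \<in> verts \<Delta> \<and> g = h"
| "path_in G \<iota> \<Delta> g (e # es) h \<longleftrightarrow>
     g \<in> verts \<Delta> \<and> e \<in> edges \<Delta> \<and> src e = g \<and> path_in G \<iota> \<Delta> (tgt G \<iota> e) es h"

definition path_verts ::
  "('g, 'm) monoid_scheme \<Rightarrow> ('x \<Rightarrow> 'g) \<Rightarrow> 'g \<Rightarrow> ('g, 'x) edge list \<Rightarrow> 'g list" where
  "path_verts G \<iota> g es = g # map (tgt G \<iota>) es"

definition simple_path ::
  "('g, 'm) monoid_scheme \<Rightarrow> 'x set \<Rightarrow> ('x \<Rightarrow> 'g) \<Rightarrow>
   'g \<Rightarrow> ('g, 'x) edge list \<Rightarrow> 'g \<Rightarrow> bool" where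
  "simple_path G X \<iota> g es h \<longleftrightarrow>
     path_in G \<iota> (Cay G X) g es h \<and> distinct (path_verts G \<iota> g es)"

definition simple_cycle ::
  "('g, 'm) monoid_scheme \<Rightarrow> 'x set \<Rightarrow> ('x \<Rightarrow> 'g) \<Rightarrow> ('g, 'x) edge list \<Rightarrow> bool" where
  "simple_cycle G X \<iota> es \<longleftrightarrow>
     (\<exists>g. path_in G \<iota> (Cay G X) g es g) \<and> distinct (map src es)"

definition spanned ::
  "('g, 'm) monoid_scheme \<Rightarrow> ('x \<Rightarrow> 'g) \<Rightarrow> 'g \<Rightarrow> ('g, 'x) edge list \<Rightarrow> ('g, 'x) graph" where
  "spanned G \<iota> g es =
     \<lparr>verts = set (path_verts G \<iota> g es), edges = set es \<union> einv G \<iota> ` set es\<rparr>"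

definition connected_graph ::
  "('g, 'm) monoid_scheme \<Rightarrow> ('x \<Rightarrow> 'g) \<Rightarrow> ('g, 'x) graph \<Rightarrow> bool" where
  "connected_graph G \<iota> \<Delta> \<longleftrightarrow> (\<forall>u \<in> verts \<Delta>. \<forall>v \<in> verts \<Delta>. \<exists>es. path_in G \<iota> \<Delta> u es v)"


section \<open>Inverse monoids, congruences and quotients\<close>

text \<open>Inverse monoids are structures in the signature with multiplication, unit and inversion.\<close>

record 'a inv_monoid = "'a monoid" +
  minv :: "'a \<Rightarrow> 'a"

definition congruence :: "('a, 'm) inv_monoid_scheme \<Rightarrow> ('a \<times> 'a) set \<Rightarrow> bool" where
  "congruence M r \<longleftrightarrow>
     equiv (carrier M) r \<and>
     (\<forall>(a, a') \<in> r. \<forall>(b, b') \<in> r. (a \<otimes>\<^bsub>M\<^esub> b, a' \<otimes>\<^bsub>M\<^esub> b') \<in> r) \<and>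
     (\<forall>(a, a') \<in> r. (minv M a, minv M a') \<in> r)"

definition congruence_gen ::
  "('a, 'm) inv_monoid_scheme \<Rightarrow> ('a \<times> 'a) set \<Rightarrow> ('a \<times> 'a) set" where
  "congruence_gen M R = \<Inter>{r. congruence M r \<and> R \<subseteq> r}"

definition quotient_monoid ::
  "('a, 'm) inv_monoid_scheme \<Rightarrow> ('a \<times> 'a) set \<Rightarrow> 'a set inv_monoid" where
  "quotient_monoid M r =
     \<lparr>carrier = carrier M // r,
      mult = (\<lambda>A B. \<Union>a\<in>A. \<Union>b\<in>B. r `` {a \<otimes>\<^bsub>M\<^esub> b}),
      one = r `` {\<one>\<^bsub>M\<^esub>},
      minv = (\<lambda>A. \<Union>a\<in>A. r `` {minv M a})\<rparr>"

definition inv_monoid_iso ::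
  "('a, 'm) inv_monoid_scheme \<Rightarrow> ('b, 'n) inv_monoid_scheme \<Rightarrow> ('a \<Rightarrow> 'b) set" where
  "inv_monoid_iso M N =
     {\<phi> \<in> iso M N. \<phi> \<one>\<^bsub>M\<^esub> = \<one>\<^bsub>N\<^esub> \<and> (\<forall>a \<in> carrier M. \<phi> (minv M a) = minv N (\<phi> a))}"


section \<open>The Margolis--Meakin expansion and its quotient\<close>

definition trivial_graph :: "('g, 'm) monoid_scheme \<Rightarrow> ('g, 'x) graph" where
  "trivial_graph G = \<lparr>verts = {\<one>\<^bsub>G\<^esub>}, edges = {}\<rparr>"

definition MM ::
  "('g, 'm) monoid_scheme \<Rightarrow> 'x set \<Rightarrow> ('x \<Rightarrow> 'g) \<Rightarrow> (('g, 'x) graph \<times> 'g) inv_monoid" where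
  "MM G X \<iota> =
     \<lparr>carrier = {(\<Gamma>, g). subgraph G X \<iota> \<Gamma> \<and> finite_graph \<Gamma> \<and> connected_graph G \<iota> \<Gamma> \<and>
                        \<one>\<^bsub>G\<^esub> \<in> verts \<Gamma> \<and> g \<in> verts \<Gamma>},
      mult = (\<lambda>(\<Delta>, g) (\<Xi>, h). (gunion \<Delta> (translate G g \<Xi>), g \<otimes>\<^bsub>G\<^esub> h)),
      one = (trivial_graph G, \<one>\<^bsub>G\<^esub>),
      minv = (\<lambda>(\<Delta>, g). (translate G (inv\<^bsub>G\<^esub> g) \<Delta>, inv\<^bsub>G\<^esub> g))\<rparr>"

definition gen_graph ::
  "('g, 'm) monoid_scheme \<Rightarrow> ('x \<Rightarrow> 'g) \<Rightarrow> 'x \<Rightarrow> ('g, 'x) graph" where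
  "gen_graph G \<iota> x = spanned G \<iota> \<one>\<^bsub>G\<^esub> [(\<one>\<^bsub>G\<^esub>, Pos x)]"

definition MM_gen ::
  "('g, 'm) monoid_scheme \<Rightarrow> ('x \<Rightarrow> 'g) \<Rightarrow> 'x \<Rightarrow> ('g, 'x) graph \<times> 'g" where
  "MM_gen G \<iota> x = (gen_graph G \<iota> x, \<iota> x)"

definition xi ::
  "('g, 'm) monoid_scheme \<Rightarrow> 'x set \<Rightarrow> ('x \<Rightarrow> 'g) \<Rightarrow>
   ((('g, 'x) graph \<times> 'g) \<times> (('g, 'x) graph \<times> 'g)) set" where
  "xi G X \<iota> = congruence_gen (MM G X \<iota>)
     {((spanned G \<iota> \<one>\<^bsub>G\<^esub> p, g), (spanned G \<iota> \<one>\<^bsub>G\<^esub> q, g)) | p q g.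
        g \<in> carrier G \<and> simple_path G X \<iota> \<one>\<^bsub>G\<^esub> p g \<and> simple_path G X \<iota> \<one>\<^bsub>G\<^esub> q g}"

definition M_sF ::
  "('g, 'm) monoid_scheme \<Rightarrow> 'x set \<Rightarrow> ('x \<Rightarrow> 'g) \<Rightarrow> (('g, 'x) graph \<times> 'g) set inv_monoid" where
  "M_sF G X \<iota> = quotient_monoid (MM G X \<iota>) (xi G X \<iota>)"

definition M_sF_gen ::
  "('g, 'm) monoid_scheme \<Rightarrow> 'x set \<Rightarrow> ('x \<Rightarrow> 'g) \<Rightarrow> 'x \<Rightarrow> (('g, 'x) graph \<times> 'g) set" where
  "M_sF_gen G X \<iota> x = xi G X \<iota> `` {MM_gen G \<iota> x}"


section \<open>Cyclic subgraphs and the inverse monoid of compact subgraphs\<close>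

definition cyclic_subgraph ::
  "('g, 'm) monoid_scheme \<Rightarrow> 'x set \<Rightarrow> ('x \<Rightarrow> 'g) \<Rightarrow> ('g, 'x) graph \<Rightarrow> bool" where
  "cyclic_subgraph G X \<iota> \<Delta> \<longleftrightarrow>
     subgraph G X \<iota> \<Delta> \<and>
     (\<forall>e \<in> edges \<Delta>. \<forall>es. simple_cycle G X \<iota> es \<and> e \<in> set es \<longrightarrow> set es \<subseteq> edges \<Delta>)"

definition cyclic_closure ::
  "('g, 'm) monoid_scheme \<Rightarrow> 'x set \<Rightarrow> ('x \<Rightarrow> 'g) \<Rightarrow> ('g, 'x) graph \<Rightarrow> ('g, 'x) graph" where
  "cyclic_closure G X \<iota> \<Delta> =
     \<lparr>verts = \<Inter>{verts \<Xi> | \<Xi>. cyclic_subgraph G X \<iota> \<Xi> \<and> gle \<Delta> \<Xi>},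
      edges = \<Inter>{edges \<Xi> | \<Xi>. cyclic_subgraph G X \<iota> \<Xi> \<and> gle \<Delta> \<Xi>}\<rparr>"

definition compact_subgraph ::
  "('g, 'm) monoid_scheme \<Rightarrow> 'x set \<Rightarrow> ('x \<Rightarrow> 'g) \<Rightarrow> ('g, 'x) graph \<Rightarrow> bool" where
  "compact_subgraph G X \<iota> \<Delta> \<longleftrightarrow>
     (\<exists>F. subgraph G X \<iota> F \<and> finite_graph F \<and> connected_graph G \<iota> F \<and>
          \<Delta> = cyclic_closure G X \<iota> F)"

text \<open>The trivial graph has no edges, so it is its own cyclic closure.\<close>

definition S_circ ::
  "('g, 'm) monoid_scheme \<Rightarrow> 'x set \<Rightarrow> ('x \<Rightarrow> 'g) \<Rightarrow> (('g, 'x) graph \<times> 'g) inv_monoid" where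
  "S_circ G X \<iota> =
     \<lparr>carrier = {(\<Delta>, g). g \<in> carrier G \<and> compact_subgraph G X \<iota> \<Delta> \<and> connected_graph G \<iota> \<Delta> \<and>
                        \<one>\<^bsub>G\<^esub> \<in> verts \<Delta> \<and> g \<in> verts \<Delta>},
      mult = (\<lambda>(\<Delta>, g) (\<Xi>, h).
                (cyclic_closure G X \<iota> (gunion \<Delta> (translate G g \<Xi>)), g \<otimes>\<^bsub>G\<^esub> h)),
      one = (trivial_graph G, \<one>\<^bsub>G\<^esub>),
      minv = (\<lambda>(\<Delta>, g). (translate G (inv\<^bsub>G\<^esub> g) \<Delta>, inv\<^bsub>G\<^esub> g))\<rparr>"

definition S_circ_gen ::
  "('g, 'm) monoid_scheme \<Rightarrow> 'x set \<Rightarrow> ('x \<Rightarrow> 'g) \<Rightarrow> 'x \<Rightarrow> ('g, 'x) graph \<times> 'g" where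
  "S_circ_gen G X \<iota> x = (cyclic_closure G X \<iota> (gen_graph G \<iota> x), \<iota> x)"

text \<open>The intersection defining the cyclic closure is the smallest cyclic subgraph.\<close>

lemma (in X_generated_group) lval_closed:
  "a \<in> letters X \<Longrightarrow> lval G \<iota> a \<in> carrier G"
  using gens_closed by (auto simp: letters_def Pi_iff)

lemma (in X_generated_group) cyclic_subgraph_Cay: "cyclic_subgraph G X \<iota> (Cay G X)"
proof -
  have linv_mem: "linv a \<in> letters X" if "a \<in> letters X" for a
    using that by (auto simp: letters_def)
  have sub: "set es \<subseteq> edges (Cay G X)" if "path_in G \<iota> (Cay G X) g es h" for g es h
    using that by (induction es arbitrary: g) auto
  have "subgraph G X \<iota> (Cay G X)"
    by (auto simp: subgraph_def Cay_def src_def tgt_def einv_def lval_closed linv_mem)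
  then show ?thesis
    using sub by (auto simp: cyclic_subgraph_def simple_cycle_def)
qed

lemma (in X_generated_group) cyclic_closure_smallest:
  assumes "subgraph G X \<iota> \<Delta>"
  shows "cyclic_subgraph G X \<iota> (cyclic_closure G X \<iota> \<Delta>)"
    and "gle \<Delta> (cyclic_closure G X \<iota> \<Delta>)"
    and "cyclic_subgraph G X \<iota> \<Xi> \<Longrightarrow> gle \<Delta> \<Xi> \<Longrightarrow> gle (cyclic_closure G X \<iota> \<Delta>) \<Xi>"
proof -
  have Cay: "gle \<Delta> (Cay G X)"
    using assms by (auto simp: subgraph_def gle_def)
  have "verts (cyclic_closure G X \<iota> \<Delta>) \<subseteq> verts (Cay G X)"
    "edges (cyclic_closure G X \<iota> \<Delta>) \<subseteq> edges (Cay G X)"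
    using Cay cyclic_subgraph_Cay by (auto simp: cyclic_closure_def)
  then show "cyclic_subgraph G X \<iota> (cyclic_closure G X \<iota> \<Delta>)"
    unfolding cyclic_subgraph_def subgraph_def cyclic_closure_def by (simp, blast)
qed (auto simp: gle_def cyclic_closure_def)

end

theory Submission
  imports Defs
begin

text \<open>The map \<open>(\<Gamma>, g) \<mapsto> (\<Gamma>\<^sup>\<circ>, g)\<close> is a surjective homomorphism, and its kernel is \<open>\<xi>\<^sub>G\<close>.
  A connected cyclic subgraph contains every simple path between two of its vertices, so simple
  paths with the same ends span graphs with the same closure, and \<open>\<xi>\<^sub>G\<close> lies in the kernel.
  Conversely, if \<open>\<Gamma>\<close> contains an edge of a simple cycle, then replacing the inverse of this edge
  by the rest of the cycle shows that adding the whole cycle to \<open>\<Gamma>\<close> does not change the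
  \<open>\<xi>\<^sub>G\<close>-class of \<open>(\<Gamma>, g)\<close>. As \<open>\<Gamma>\<^sup>\<circ>\<close> is exhausted by such additions, all finite connected subgraphs
  with the same closure become equal.\<close>


section \<open>Congruences and kernels\<close>

text \<open>Equality of values under \<open>f\<close> is an equivalence, and the compatibility of
  \<open>f\<close> with products and inverses transfers to it. This supplies a concrete congruence
  above a generated one.\<close>

lemma congruence_kernel:
  fixes M :: "('a, 'm) inv_monoid_scheme" and N :: "('b, 'n) inv_monoid_scheme"
  assumes "\<And>a b. a \<in> carrier M \<Longrightarrow> b \<in> carrier M \<Longrightarrow> a \<otimes>\<^bsub>M\<^esub> b \<in> carrier M"
    and "\<And>a. a \<in> carrier M \<Longrightarrow> minv M a \<in> carrier M"
    and "\<And>a b. a \<in> carrier M \<Longrightarrow> b \<in> carrier M \<Longrightarrow> f (a \<otimes>\<^bsub>M\<^esub> b) = f a \<otimes>\<^bsub>N\<^esub> f b"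
    and "\<And>a. a \<in> carrier M \<Longrightarrow> f (minv M a) = minv N (f a)"
  shows "congruence M {(a, b). a \<in> carrier M \<and> b \<in> carrier M \<and> f a = f b}"
  unfolding congruence_def
  by (intro conjI equivI) (auto simp: assms refl_on_def sym_def trans_def)

text \<open>All closure conditions pass to intersections. The witness \<open>r\<close> makes the
  intersected family nonempty; an empty intersection would be the universal relation, which need not
  stay inside \<open>carrier M\<close>.\<close>

lemma congruence_gen_congruence:
  assumes "congruence M r" and "R \<subseteq> r"
  shows "congruence M (congruence_gen M R)"
proof -
  let ?F = "{r. congruence M r \<and> R \<subseteq> r}"
  have F: "equiv (carrier M) s"
    "\<And>a a' b b'. (a, a') \<in> s \<Longrightarrow> (b, b') \<in> s \<Longrightarrow> (a \<otimes>\<^bsub>M\<^esub> b, a' \<otimes>\<^bsub>M\<^esub> b') \<in> s"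
    "\<And>a a'. (a, a') \<in> s \<Longrightarrow> (minv M a, minv M a') \<in> s" if "s \<in> ?F" for s
    using that by (auto simp: congruence_def)
  have r: "r \<in> ?F" using assms by simp
  have "equiv (carrier M) (\<Inter>?F)"
  proof (rule equivI)
    show "\<Inter>?F \<subseteq> carrier M \<times> carrier M"
      using F(1)[OF r] r by (blast dest: equiv_type)
    show "refl_on (carrier M) (\<Inter>?F)"
      using F(1) unfolding equiv_def refl_on_def by blast
    show "sym (\<Inter>?F)"
      using F(1) unfolding equiv_def by (meson InterE InterI symD symI)
    show "trans (\<Inter>?F)"
      using F(1) unfolding equiv_def by (meson InterE InterI transD transI)
  qed
  moreover have "(a \<otimes>\<^bsub>M\<^esub> b, a' \<otimes>\<^bsub>M\<^esub> b') \<in> \<Inter>?F"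
    if "(a, a') \<in> \<Inter>?F" "(b, b') \<in> \<Inter>?F" for a a' b b'
    using that F(2) by (meson InterE InterI)
  moreover have "(minv M a, minv M a') \<in> \<Inter>?F" if "(a, a') \<in> \<Inter>?F" for a a'
    using that F(3) by (meson InterE InterI)
  ultimately show ?thesis
    unfolding congruence_gen_def congruence_def by blast
qed

lemma congruence_gen_least:
  "congruence M r \<Longrightarrow> R \<subseteq> r \<Longrightarrow> congruence_gen M R \<subseteq> r"
  by (auto simp: congruence_gen_def)

lemma congruence_gen_superset: "R \<subseteq> congruence_gen M R"
  by (auto simp: congruence_gen_def)

text \<open>This is the first isomorphism theorem, with the value on classes recorded as well, so
  that generators can be traced. One direction of \<open>ker\<close> makes the induced map well
  defined, the other makes it injective.\<close>

lemma quotient_monoid_iso: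
  fixes M :: "('a, 'm) inv_monoid_scheme" and N :: "('b, 'n) inv_monoid_scheme"
  assumes r: "congruence M r"
    and one: "\<one>\<^bsub>M\<^esub> \<in> carrier M"
    and closed: "\<And>a b. a \<in> carrier M \<Longrightarrow> b \<in> carrier M \<Longrightarrow> a \<otimes>\<^bsub>M\<^esub> b \<in> carrier M"
    and inv_closed: "\<And>a. a \<in> carrier M \<Longrightarrow> minv M a \<in> carrier M"
    and hom: "\<And>a b. a \<in> carrier M \<Longrightarrow> b \<in> carrier M \<Longrightarrow> f (a \<otimes>\<^bsub>M\<^esub> b) = f a \<otimes>\<^bsub>N\<^esub> f b"
    and hom_one: "f \<one>\<^bsub>M\<^esub> = \<one>\<^bsub>N\<^esub>"
    and hom_inv: "\<And>a. a \<in> carrier M \<Longrightarrow> f (minv M a) = minv N (f a)"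
    and surj: "f ` carrier M = carrier N"
    and ker: "\<And>a b. a \<in> carrier M \<Longrightarrow> b \<in> carrier M \<Longrightarrow> (a, b) \<in> r \<longleftrightarrow> f a = f b"
  shows "\<exists>\<phi>. \<phi> \<in> inv_monoid_iso (quotient_monoid M r) N \<and>
             (\<forall>a \<in> carrier M. \<phi> (r `` {a}) = f a)"
proof -
  have eq: "equiv (carrier M) r"
    and mult: "\<And>a a' b b'. (a, a') \<in> r \<Longrightarrow> (b, b') \<in> r \<Longrightarrow> (a \<otimes>\<^bsub>M\<^esub> b, a' \<otimes>\<^bsub>M\<^esub> b') \<in> r"
    and minv: "\<And>a a'. (a, a') \<in> r \<Longrightarrow> (minv M a, minv M a') \<in> r"
    using r by (auto simp: congruence_def)
  \<comment> \<open>Since \<open>f\<close> is constant on each class, the image of a class is a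
    singleton and \<open>the_elem\<close> reads off its value.\<close>
  define \<phi> where "\<phi> = (\<lambda>A. the_elem (f ` A))"
  have \<phi>: "\<phi> (r `` {a}) = f a" if a: "a \<in> carrier M" for a
  proof -
    have "a \<in> r `` {a}" using eq a by (rule equiv_class_self)
    moreover have "f b = f a" if "b \<in> r `` {a}" for b
      using that ker[of a b] a equiv_type[OF eq] by auto
    ultimately have "f ` (r `` {a}) = {f a}" by blast
    then show ?thesis by (simp add: \<phi>_def)
  qed
  let ?Q = "quotient_monoid M r"
  have Qmult: "r `` {a} \<otimes>\<^bsub>?Q\<^esub> r `` {b} = r `` {a \<otimes>\<^bsub>M\<^esub> b}"
    if ab: "a \<in> carrier M" "b \<in> carrier M" for a b
  proof -
    \<comment> \<open>The unions defining the product of classes run over constant families with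
      nonempty index sets, hence collapse to a single class.\<close>
    have "(\<Union>b\<in>r `` {b}. r `` {a' \<otimes>\<^bsub>M\<^esub> b}) = r `` {a \<otimes>\<^bsub>M\<^esub> b}" if "(a, a') \<in> r" for a'
      using equiv_class_eq[OF eq mult[OF that]]
      by (intro UN_constant_eq[OF equiv_class_self[OF eq ab(2)]]) blast
    then have "(\<Union>a\<in>r `` {a}. \<Union>b\<in>r `` {b}. r `` {a \<otimes>\<^bsub>M\<^esub> b}) = r `` {a \<otimes>\<^bsub>M\<^esub> b}"
      by (intro UN_constant_eq[OF equiv_class_self[OF eq ab(1)]]) blast
    then show ?thesis by (simp add: quotient_monoid_def)
  qed
  have Qinv: "minv ?Q (r `` {a}) = r `` {minv M a}" if a: "a \<in> carrier M" for a
  proof -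
    have "(\<Union>a\<in>r `` {a}. r `` {minv M a}) = r `` {minv M a}"
      using equiv_class_eq[OF eq minv]
      by (intro UN_constant_eq[OF equiv_class_self[OF eq a]]) blast
    then show ?thesis by (simp add: quotient_monoid_def)
  qed
  have car: "carrier ?Q = (\<lambda>a. r `` {a}) ` carrier M"
    by (auto simp: quotient_monoid_def quotient_def)
  have one': "\<one>\<^bsub>?Q\<^esub> = r `` {\<one>\<^bsub>M\<^esub>}" by (simp add: quotient_monoid_def)
  have "inj_on \<phi> (carrier ?Q)"
    using ker equiv_class_eq[OF eq] by (auto simp: inj_on_def car \<phi>)
  moreover have "\<phi> ` carrier ?Q = carrier N"
    using surj by (auto simp: car image_image \<phi>)
  moreover have "\<phi> \<in> hom ?Q N"
    using surj by (auto simp: hom_def car \<phi> Qmult closed hom)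
  moreover have "\<phi> \<one>\<^bsub>?Q\<^esub> = \<one>\<^bsub>N\<^esub>" by (simp add: one' \<phi> one hom_one)
  moreover have "\<phi> (minv ?Q A) = minv N (\<phi> A)" if "A \<in> carrier ?Q" for A
    using that by (auto simp: car Qinv \<phi> inv_closed hom_inv)
  ultimately have "\<phi> \<in> inv_monoid_iso ?Q N"
    by (auto simp: inv_monoid_iso_def iso_def bij_betw_def)
  then show ?thesis using \<phi> by blast
qed


section \<open>Paths\<close>

lemma gle_refl: "gle \<Delta> \<Delta>"
  by (simp add: gle_def)

lemma gle_trans: "gle \<Delta> \<Xi> \<Longrightarrow> gle \<Xi> \<Theta> \<Longrightarrow> gle \<Delta> \<Theta>"
  by (auto simp: gle_def)

lemma gle_antisym: "gle \<Delta> \<Xi> \<Longrightarrow> gle \<Xi> \<Delta> \<Longrightarrow> \<Delta> = (\<Xi> :: ('g, 'x) graph)"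
  by (auto simp: gle_def)

lemma gle_gunion: "gle (gunion \<Delta> \<Xi>) \<Theta> \<longleftrightarrow> gle \<Delta> \<Theta> \<and> gle \<Xi> \<Theta>"
  by (auto simp: gle_def gunion_def)

lemma gle_gunion1: "gle \<Delta> (gunion \<Delta> \<Xi>)"
  and gle_gunion2: "gle \<Xi> (gunion \<Delta> \<Xi>)"
  by (auto simp: gle_def gunion_def)

lemma verts_gunion: "verts (gunion \<Delta> \<Xi>) = verts \<Delta> \<union> verts \<Xi>"
  by (simp add: gunion_def)

lemma gunion_absorb: "gle \<Delta> \<Xi> \<Longrightarrow> gunion \<Delta> \<Xi> = (\<Xi> :: ('g, 'x) graph)"
  by (auto simp: gle_def gunion_def Un_absorb1)

lemma gunion_commute: "gunion \<Delta> \<Xi> = gunion \<Xi> \<Delta>"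
  by (auto simp: gunion_def)

section \<open>Concatenation, restriction and shortening of paths\<close>

lemma path_in_append:
  "path_in G \<iota> \<Delta> g (xs @ ys) h \<longleftrightarrow> (\<exists>k. path_in G \<iota> \<Delta> g xs k \<and> path_in G \<iota> \<Delta> k ys h)"
proof (induction xs arbitrary: g)
  case Nil
  then show ?case by (cases ys) auto
qed auto

lemma path_in_start: "path_in G \<iota> \<Delta> g es h \<Longrightarrow> g \<in> verts \<Delta>"
  by (cases es) auto

lemma path_in_end: "path_in G \<iota> \<Delta> g es h \<Longrightarrow> h \<in> verts \<Delta>"
  by (induction es arbitrary: g) auto

lemma path_in_verts: "path_in G \<iota> \<Delta> g es h \<Longrightarrow> set (path_verts G \<iota> g es) \<subseteq> verts \<Delta>"
  by (induction es arbitrary: g) (auto simp: path_verts_def)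

lemma path_in_edges: "path_in G \<iota> \<Delta> g es h \<Longrightarrow> set es \<subseteq> edges \<Delta>"
  by (induction es arbitrary: g) auto

lemma path_in_mono: "path_in G \<iota> \<Delta> g es h \<Longrightarrow> gle \<Delta> \<Xi> \<Longrightarrow> path_in G \<iota> \<Xi> g es h"
  by (induction es arbitrary: g) (auto simp: gle_def)

lemma path_in_restrict:
  "path_in G \<iota> \<Delta> g es h \<Longrightarrow> set es \<subseteq> edges \<Xi> \<Longrightarrow> set (path_verts G \<iota> g es) \<subseteq> verts \<Xi> \<Longrightarrow>
   path_in G \<iota> \<Xi> g es h"
  by (induction es arbitrary: g) (auto simp: path_verts_def)

lemma path_verts_Cons: "path_verts G \<iota> g (e # es) = g # path_verts G \<iota> (tgt G \<iota> e) es"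
  by (simp add: path_verts_def)

text \<open>Each edge starts where the previous one ends. The identity links the two notions of
  simplicity: paths are tested on all their vertices, cycles only on the sources of their
  edges.\<close>

lemma path_verts_eq_src:
  "path_in G \<iota> \<Delta> g es h \<Longrightarrow> path_verts G \<iota> g es = map src es @ [h]"
  by (induction es arbitrary: g) (auto simp: path_verts_def)

lemma path_in_prefix:
  "path_in G \<iota> \<Delta> g es h \<Longrightarrow> v \<in> set (path_verts G \<iota> g es) \<Longrightarrow> \<exists>ys. path_in G \<iota> \<Delta> g ys v"
proof (induction es arbitrary: g)
  case Nil
  then show ?case by (auto simp: path_verts_def intro: exI[of _ "[]"])
next
  case (Cons e es)
  show ?case
  proof (cases "v = g")
    case True
    with Cons.prems show ?thesis by (auto intro: exI[of _ "[]"])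
  next
    case False
    then obtain ys where "path_in G \<iota> \<Delta> (tgt G \<iota> e) ys v"
      using Cons by (auto simp: path_verts_Cons)
    then show ?thesis using Cons.prems by (auto intro: exI[of _ "e # ys"])
  qed
qed

lemma simple_path_suffix:
  "path_in G \<iota> \<Delta> k es h \<Longrightarrow> distinct (path_verts G \<iota> k es) \<Longrightarrow> g \<in> set (path_verts G \<iota> k es) \<Longrightarrow>
   \<exists>zs. path_in G \<iota> \<Delta> g zs h \<and> distinct (path_verts G \<iota> g zs)"
proof (induction es arbitrary: k)
  case Nil
  then show ?case by (auto simp: path_verts_def intro: exI[of _ "[]"])
next
  case (Cons e es)
  show ?case
  proof (cases "g = k")
    case True
    with Cons.prems show ?thesis by blast
  next
    case False
    with Cons show ?thesis by (auto simp: path_verts_Cons)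
  qed
qed

text \<open>Loops are removed from the end of the path backwards: if the start already occurs on the
  simple path obtained for the tail, the suffix from that occurrence suffices; otherwise the first
  edge is put in front.\<close>

lemma ex_simple_path:
  "path_in G \<iota> \<Delta> g es h \<Longrightarrow> \<exists>zs. path_in G \<iota> \<Delta> g zs h \<and> distinct (path_verts G \<iota> g zs)"
proof (induction es arbitrary: g)
  case Nil
  then show ?case by (auto simp: path_verts_def intro!: exI[of _ "[]"])
next
  case (Cons e es)
  then obtain zs where zs: "path_in G \<iota> \<Delta> (tgt G \<iota> e) zs h" "distinct (path_verts G \<iota> (tgt G \<iota> e) zs)"
    by auto
  show ?case
  proof (cases "g \<in> set (path_verts G \<iota> (tgt G \<iota> e) zs)")
    case True
    with zs show ?thesis by (blast intro: simple_path_suffix)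
  next
    case False
    with zs Cons.prems show ?thesis
      by (auto simp: path_verts_Cons intro!: exI[of _ "e # zs"])
  qed
qed

text \<open>Finitely many elements are collected one at a time, directedness merging two members of
  the family at each stage. The function \<open>h\<close> lets the same statement serve for vertex
  sets and for edge sets.\<close>

lemma directed_union_finite:
  assumes "finite A" and "A \<subseteq> (\<Union>\<Gamma>\<in>R. h \<Gamma>)" and "R \<noteq> {}"
    and "\<And>\<Gamma> \<Delta>. \<Gamma> \<in> R \<Longrightarrow> \<Delta> \<in> R \<Longrightarrow> \<exists>\<Theta>\<in>R. h \<Gamma> \<subseteq> h \<Theta> \<and> h \<Delta> \<subseteq> h \<Theta>"
  shows "\<exists>\<Gamma>\<in>R. A \<subseteq> h \<Gamma>"
  using assms(1,2)
proof (induction A rule: finite_induct)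
  case empty
  then show ?case using assms(3) by auto
next
  case (insert a A)
  then obtain \<Gamma> \<Delta> where \<Gamma>: "\<Gamma> \<in> R" "A \<subseteq> h \<Gamma>" and \<Delta>: "\<Delta> \<in> R" "a \<in> h \<Delta>" by auto
  from assms(4)[OF \<Gamma>(1) \<Delta>(1)] obtain \<Theta> where "\<Theta> \<in> R" "h \<Gamma> \<subseteq> h \<Theta>" "h \<Delta> \<subseteq> h \<Theta>"
    by blast
  with \<Gamma> \<Delta> show ?case by blast
qed

text \<open>The action on a single edge is named so that it can be mapped over the edge list of a
  path.\<close>

definition etranslate ::
  "('g, 'm) monoid_scheme \<Rightarrow> 'g \<Rightarrow> ('g, 'x) edge \<Rightarrow> ('g, 'x) edge" where
  "etranslate G k e = (k \<otimes>\<^bsub>G\<^esub> fst e, snd e)"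

lemma verts_translate: "verts (translate G k \<Delta>) = (\<lambda>h. k \<otimes>\<^bsub>G\<^esub> h) ` verts \<Delta>"
  by (simp add: translate_def)

lemma edges_translate: "edges (translate G k \<Delta>) = etranslate G k ` edges \<Delta>"
  by (auto simp: translate_def etranslate_def case_prod_unfold)

lemma gle_translate: "gle \<Delta> \<Xi> \<Longrightarrow> gle (translate G k \<Delta>) (translate G k \<Xi>)"
  by (auto simp: gle_def verts_translate edges_translate)

lemma finite_graph_translate: "finite_graph \<Delta> \<Longrightarrow> finite_graph (translate G k \<Delta>)"
  by (simp add: finite_graph_def verts_translate edges_translate)

lemma finite_graph_gunion: "finite_graph \<Delta> \<Longrightarrow> finite_graph \<Xi> \<Longrightarrow> finite_graph (gunion \<Delta> \<Xi>)"
  by (simp add: finite_graph_def gunion_def)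

lemma finite_graph_spanned: "finite_graph (spanned G \<iota> g es)"
  by (simp add: finite_graph_def spanned_def)

lemma path_in_spanned:
  assumes "path_in G \<iota> \<Delta> g es h"
  shows "path_in G \<iota> (spanned G \<iota> g es) g es h"
  using assms by (rule path_in_restrict) (auto simp: spanned_def)

context X_generated_group
begin

section \<open>Subgraphs of the Cayley graph\<close>

lemma linv_letters: "a \<in> letters X \<Longrightarrow> linv a \<in> letters X"
  by (auto simp: letters_def)

lemma lval_linv: "a \<in> letters X \<Longrightarrow> lval G \<iota> (linv a) = inv (lval G \<iota> a)"
  using gens_closed by (auto simp: letters_def Pi_iff)

lemma linv_linv: "linv (linv a) = a"
  by (cases a) auto

lemma subgraph_Cay: "subgraph G X \<iota> (Cay G X)"
  using cyclic_subgraph_Cay by (simp add: cyclic_subgraph_def)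

lemma subgraph_gle_Cay: "subgraph G X \<iota> \<Delta> \<Longrightarrow> gle \<Delta> (Cay G X)"
  by (simp add: subgraph_def gle_def)

lemma Cay_edge:
  assumes "e \<in> edges (Cay G X)"
  shows "src e \<in> carrier G" "tgt G \<iota> e \<in> carrier G" "einv G \<iota> e \<in> edges (Cay G X)"
    and "src (einv G \<iota> e) = tgt G \<iota> e" "tgt G \<iota> (einv G \<iota> e) = src e"
    and "einv G \<iota> (einv G \<iota> e) = e"
proof -
  obtain g a where e: "e = (g, a)" "g \<in> carrier G" "a \<in> letters X"
    using assms by (auto simp: Cay_def)
  have "g \<otimes> lval G \<iota> a \<otimes> inv (lval G \<iota> a) = g"
    using e lval_closed by (simp add: m_assoc)
  then show "src e \<in> carrier G" "tgt G \<iota> e \<in> carrier G" "einv G \<iota> e \<in> edges (Cay G X)"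
    "src (einv G \<iota> e) = tgt G \<iota> e" "tgt G \<iota> (einv G \<iota> e) = src e"
    "einv G \<iota> (einv G \<iota> e) = e"
    using e lval_closed linv_letters
    by (auto simp: src_def tgt_def einv_def Cay_def lval_linv linv_linv)
qed

lemma subgraph_edge_Cay: "subgraph G X \<iota> \<Delta> \<Longrightarrow> e \<in> edges \<Delta> \<Longrightarrow> e \<in> edges (Cay G X)"
  by (auto simp: subgraph_def)

lemma subgraph_edge:
  assumes "subgraph G X \<iota> \<Delta>" "e \<in> edges \<Delta>"
  shows "src e \<in> verts \<Delta>" "tgt G \<iota> e \<in> verts \<Delta>" "einv G \<iota> e \<in> edges \<Delta>"
  using assms by (auto simp: subgraph_def)

lemma subgraph_vert: "subgraph G X \<iota> \<Delta> \<Longrightarrow> v \<in> verts \<Delta> \<Longrightarrow> v \<in> carrier G"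
  by (auto simp: subgraph_def Cay_def)

lemma subgraph_gunion:
  "subgraph G X \<iota> \<Delta> \<Longrightarrow> subgraph G X \<iota> \<Xi> \<Longrightarrow> subgraph G X \<iota> (gunion \<Delta> \<Xi>)"
  by (auto simp: subgraph_def gunion_def)

text \<open>A subgraph contains the endpoints of its edges, so only the initial vertex needs a
  separate check, for the sake of the empty path.\<close>

lemma path_in_subgraph:
  assumes "subgraph G X \<iota> \<Delta>"
  shows "path_in G \<iota> \<Xi> g es h \<Longrightarrow> set es \<subseteq> edges \<Delta> \<Longrightarrow> g \<in> verts \<Delta> \<Longrightarrow> path_in G \<iota> \<Delta> g es h"
  using assms by (induction es arbitrary: g) (auto simp: subgraph_def)

lemma path_in_reverse:
  assumes "subgraph G X \<iota> \<Delta>"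
  shows "path_in G \<iota> \<Delta> g es h \<Longrightarrow> path_in G \<iota> \<Delta> h (rev (map (einv G \<iota>) es)) g"
proof (induction es arbitrary: g)
  case (Cons e es)
  then have "path_in G \<iota> \<Delta> (tgt G \<iota> e) [einv G \<iota> e] g"
    using subgraph_edge[OF assms, of e] Cay_edge[OF subgraph_edge_Cay[OF assms], of e] by auto
  then show ?case using Cons by (auto simp: path_in_append)
qed auto

text \<open>A path from \<open>u\<close> to \<open>v\<close> arises by running backwards from
  \<open>u\<close> to the root \<open>k\<close> and then forwards to \<open>v\<close>.\<close>

lemma connected_graph_root:
  assumes "subgraph G X \<iota> \<Delta>" and "\<And>v. v \<in> verts \<Delta> \<Longrightarrow> \<exists>es. path_in G \<iota> \<Delta> k es v"
  shows "connected_graph G \<iota> \<Delta>"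
  unfolding connected_graph_def
  using assms(2) path_in_reverse[OF assms(1)] path_in_append by metis

lemma connected_graph_gunion:
  assumes "subgraph G X \<iota> \<Delta>" "subgraph G X \<iota> \<Xi>"
    and "connected_graph G \<iota> \<Delta>" "connected_graph G \<iota> \<Xi>" "k \<in> verts \<Delta>" "k \<in> verts \<Xi>"
  shows "connected_graph G \<iota> (gunion \<Delta> \<Xi>)"
proof (rule connected_graph_root[OF subgraph_gunion[OF assms(1,2)], of k])
  fix v
  assume "v \<in> verts (gunion \<Delta> \<Xi>)"
  then consider "v \<in> verts \<Delta>" | "v \<in> verts \<Xi>" by (auto simp: gunion_def)
  then show "\<exists>es. path_in G \<iota> (gunion \<Delta> \<Xi>) k es v"
    using assms(3-6) unfolding connected_graph_def
    by cases (meson path_in_mono gle_gunion1 gle_gunion2)+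
qed

lemma subgraph_spanned:
  assumes "path_in G \<iota> (Cay G X) g es h"
  shows "subgraph G X \<iota> (spanned G \<iota> g es)"
proof -
  have es: "set es \<subseteq> edges (Cay G X)" and vs: "set (path_verts G \<iota> g es) \<subseteq> verts (Cay G X)"
    using assms by (rule path_in_edges, rule path_in_verts)
  have "src e \<in> set (path_verts G \<iota> g es)" if "e \<in> set es" for e
    using that by (simp add: path_verts_eq_src[OF assms])
  moreover have "tgt G \<iota> e \<in> set (path_verts G \<iota> g es)" if "e \<in> set es" for e
    using that by (simp add: path_verts_def)
  ultimately show ?thesis
    using es vs Cay_edge unfolding subgraph_def spanned_def
    by (auto 0 3 simp: subset_iff)
qed

lemma connected_graph_spanned:
  assumes "path_in G \<iota> (Cay G X) g es h"
  shows "connected_graph G \<iota> (spanned G \<iota> g es)"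
proof (rule connected_graph_root[OF subgraph_spanned[OF assms], of g])
  fix v
  assume "v \<in> verts (spanned G \<iota> g es)"
  then show "\<exists>ys. path_in G \<iota> (spanned G \<iota> g es) g ys v"
    using path_in_prefix[OF path_in_spanned[OF assms]] by (auto simp: spanned_def)
qed

lemma gle_spanned:
  assumes "subgraph G X \<iota> \<Delta>" "path_in G \<iota> \<Delta> g es h"
  shows "gle (spanned G \<iota> g es) \<Delta>"
  using path_in_verts[OF assms(2)] path_in_edges[OF assms(2)] subgraph_edge(3)[OF assms(1)]
  by (auto simp: gle_def spanned_def)


section \<open>Translations\<close>

lemma etranslate_Cay:
  assumes "k \<in> carrier G" "e \<in> edges (Cay G X)"
  shows "etranslate G k e \<in> edges (Cay G X)"
    and "src (etranslate G k e) = k \<otimes> src e"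
    and "tgt G \<iota> (etranslate G k e) = k \<otimes> tgt G \<iota> e"
    and "einv G \<iota> (etranslate G k e) = etranslate G k (einv G \<iota> e)"
  using assms lval_closed
  by (auto simp: etranslate_def Cay_def src_def tgt_def einv_def m_assoc)

lemma subgraph_translate:
  assumes "subgraph G X \<iota> \<Delta>" "k \<in> carrier G"
  shows "subgraph G X \<iota> (translate G k \<Delta>)"
  unfolding subgraph_def
proof (intro conjI ballI)
  note et = etranslate_Cay[OF assms(2) subgraph_edge_Cay[OF assms(1)]]
  show "verts (translate G k \<Delta>) \<subseteq> verts (Cay G X)"
    using assms(2) subgraph_vert[OF assms(1)] by (auto simp: verts_translate Cay_def)
  show "edges (translate G k \<Delta>) \<subseteq> edges (Cay G X)"
    using et(1) by (auto simp: edges_translate)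
  fix e
  assume "e \<in> edges (translate G k \<Delta>)"
  then obtain d where d: "d \<in> edges \<Delta>" "e = etranslate G k d"
    by (auto simp: edges_translate)
  then show "src e \<in> verts (translate G k \<Delta>)" "tgt G \<iota> e \<in> verts (translate G k \<Delta>)"
    "einv G \<iota> e \<in> edges (translate G k \<Delta>)"
    using subgraph_edge[OF assms(1)] by (auto simp: et verts_translate edges_translate)
qed

lemma translate_translate:
  assumes "subgraph G X \<iota> \<Delta>" "k \<in> carrier G" "l \<in> carrier G"
  shows "translate G k (translate G l \<Delta>) = translate G (k \<otimes> l) \<Delta>"
proof -
  have "etranslate G k (etranslate G l e) = etranslate G (k \<otimes> l) e" if "e \<in> edges \<Delta>" for e
    using subgraph_edge_Cay[OF assms(1) that] assms(2,3)
    by (auto simp: etranslate_def Cay_def m_assoc)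
  then have "edges (translate G k (translate G l \<Delta>)) = edges (translate G (k \<otimes> l) \<Delta>)"
    by (simp add: edges_translate image_image)
  moreover have "verts (translate G k (translate G l \<Delta>)) = verts (translate G (k \<otimes> l) \<Delta>)"
    using assms(2,3) subgraph_vert[OF assms(1)] by (simp add: verts_translate image_image m_assoc)
  ultimately show ?thesis by simp
qed

lemma translate_one:
  assumes "subgraph G X \<iota> \<Delta>"
  shows "translate G \<one> \<Delta> = \<Delta>"
proof -
  have "etranslate G \<one> e = e" if "e \<in> edges \<Delta>" for e
    using subgraph_edge_Cay[OF assms that] by (auto simp: etranslate_def Cay_def)
  then have "edges (translate G \<one> \<Delta>) = edges \<Delta>"
    by (simp add: edges_translate)
  moreover have "verts (translate G \<one> \<Delta>) = verts \<Delta>"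
    using subgraph_vert[OF assms] by (simp add: verts_translate)
  ultimately show ?thesis by simp
qed

lemma translate_inv_cancel:
  assumes "subgraph G X \<iota> \<Delta>" "k \<in> carrier G"
  shows "translate G k (translate G (inv k) \<Delta>) = \<Delta>"
    and "translate G (inv k) (translate G k \<Delta>) = \<Delta>"
  using assms by (simp_all add: translate_translate translate_one)

lemma path_in_translate:
  assumes "subgraph G X \<iota> \<Delta>" "k \<in> carrier G"
  shows "path_in G \<iota> \<Delta> g es h \<Longrightarrow>
    path_in G \<iota> (translate G k \<Delta>) (k \<otimes> g) (map (etranslate G k) es) (k \<otimes> h)"
  using etranslate_Cay[OF assms(2) subgraph_edge_Cay[OF assms(1)]]
  by (induction es arbitrary: g) (auto simp: verts_translate edges_translate)

text \<open>Every translate is included in the Cayley graph; translating this inclusion for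
  \<open>inv k\<close> by \<open>k\<close> gives the converse one.\<close>

lemma translate_Cay:
  assumes "k \<in> carrier G"
  shows "translate G k (Cay G X) = Cay G X"
proof -
  have "gle (translate G l (Cay G X)) (Cay G X)" if "l \<in> carrier G" for l
    using that by (intro subgraph_gle_Cay subgraph_translate subgraph_Cay)
  then show ?thesis
    using assms translate_inv_cancel(1)[OF subgraph_Cay assms]
    by (metis gle_antisym gle_translate inv_closed)
qed

lemma connected_graph_translate:
  assumes "subgraph G X \<iota> \<Delta>" "k \<in> carrier G" "connected_graph G \<iota> \<Delta>"
  shows "connected_graph G \<iota> (translate G k \<Delta>)"
  using assms(3) path_in_translate[OF assms(1,2)]
  unfolding connected_graph_def verts_translate by blast

lemma path_verts_etranslate:
  assumes "path_in G \<iota> (Cay G X) g es h" "k \<in> carrier G"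
  shows "path_verts G \<iota> (k \<otimes> g) (map (etranslate G k) es) = map (\<lambda>h. k \<otimes> h) (path_verts G \<iota> g es)"
  using path_in_edges[OF assms(1)] etranslate_Cay(3)[OF assms(2)] by (auto simp: path_verts_def)

lemma spanned_translate:
  assumes "path_in G \<iota> (Cay G X) g es h" "k \<in> carrier G"
  shows "translate G k (spanned G \<iota> g es) = spanned G \<iota> (k \<otimes> g) (map (etranslate G k) es)"
proof -
  have es: "set es \<subseteq> edges (Cay G X)" using assms(1) by (rule path_in_edges)
  have "(\<lambda>h. k \<otimes> h) ` set (path_verts G \<iota> g es)
      = set (path_verts G \<iota> (k \<otimes> g) (map (etranslate G k) es))"
    by (simp add: path_verts_etranslate[OF assms])
  moreover have "(\<lambda>e. etranslate G k (einv G \<iota> e)) ` set es = (\<lambda>e. einv G \<iota> (etranslate G k e)) ` set es"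
    using es etranslate_Cay(4)[OF assms(2)] by (intro image_cong) (auto)
  ultimately have "verts (translate G k (spanned G \<iota> g es)) =
      verts (spanned G \<iota> (k \<otimes> g) (map (etranslate G k) es))"
    "edges (translate G k (spanned G \<iota> g es)) =
      edges (spanned G \<iota> (k \<otimes> g) (map (etranslate G k) es))"
    by (simp_all add: verts_translate edges_translate spanned_def image_Un image_image)
  then show ?thesis by simp
qed

lemma simple_path_translate:
  assumes "simple_path G X \<iota> g es h" "k \<in> carrier G"
  shows "simple_path G X \<iota> (k \<otimes> g) (map (etranslate G k) es) (k \<otimes> h)"
proof -
  have p: "path_in G \<iota> (Cay G X) g es h" and d: "distinct (path_verts G \<iota> g es)"
    using assms(1) by (auto simp: simple_path_def)
  have "inj_on (\<lambda>h. k \<otimes> h) (set (path_verts G \<iota> g es))"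
    using path_in_verts[OF p] assms(2) by (auto simp: Cay_def inj_on_def subset_iff)
  then have "distinct (path_verts G \<iota> (k \<otimes> g) (map (etranslate G k) es))"
    using d by (simp add: distinct_map path_verts_etranslate[OF p assms(2)])
  then show ?thesis
    using path_in_translate[OF subgraph_Cay assms(2) p]
    by (simp add: simple_path_def translate_Cay[OF assms(2)])
qed

lemma simple_cycle_translate:
  assumes "simple_cycle G X \<iota> es" "k \<in> carrier G"
  shows "simple_cycle G X \<iota> (map (etranslate G k) es)"
proof -
  obtain g where p: "path_in G \<iota> (Cay G X) g es g" and d: "distinct (map src es)"
    using assms(1) by (auto simp: simple_cycle_def)
  have "map src (map (etranslate G k) es) = map (\<lambda>h. k \<otimes> h) (map src es)"
    using path_in_edges[OF p] etranslate_Cay(2)[OF assms(2)] by auto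
  moreover have "inj_on (\<lambda>h. k \<otimes> h) (set (map src es))"
    using path_in_edges[OF p] assms(2) Cay_edge(1) by (auto simp: inj_on_def subset_iff)
  ultimately have "distinct (map src (map (etranslate G k) es))"
    using d by (simp only: distinct_map)
  then show ?thesis
    using path_in_translate[OF subgraph_Cay assms(2) p]
    by (auto simp: simple_cycle_def translate_Cay[OF assms(2)])
qed


section \<open>Cyclic closures\<close>

abbreviation clo :: "('g, 'x) graph \<Rightarrow> ('g, 'x) graph" where
  "clo \<equiv> cyclic_closure G X \<iota>"

lemmas cyclic_clo = cyclic_closure_smallest(1)
lemmas gle_clo = cyclic_closure_smallest(2)
lemmas clo_least = cyclic_closure_smallest(3)

lemma cyclic_subgraph_subgraph: "cyclic_subgraph G X \<iota> \<Delta> \<Longrightarrow> subgraph G X \<iota> \<Delta>"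
  by (simp add: cyclic_subgraph_def)

lemma cyclic_subgraph_cycle:
  "cyclic_subgraph G X \<iota> \<Delta> \<Longrightarrow> simple_cycle G X \<iota> es \<Longrightarrow> e \<in> edges \<Delta> \<Longrightarrow> e \<in> set es \<Longrightarrow>
   set es \<subseteq> edges \<Delta>"
  by (simp add: cyclic_subgraph_def)

lemma subgraph_clo: "subgraph G X \<iota> \<Delta> \<Longrightarrow> subgraph G X \<iota> (clo \<Delta>)"
  by (simp add: cyclic_clo cyclic_subgraph_subgraph)

lemma cyclic_no_edges:
  "subgraph G X \<iota> \<Delta> \<Longrightarrow> edges \<Delta> = {} \<Longrightarrow> cyclic_subgraph G X \<iota> \<Delta>"
  by (simp add: cyclic_subgraph_def)

lemma clo_cyclic: "cyclic_subgraph G X \<iota> \<Delta> \<Longrightarrow> clo \<Delta> = \<Delta>"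
  by (meson clo_least cyclic_subgraph_subgraph gle_antisym gle_clo gle_refl)

lemma clo_between:
  "subgraph G X \<iota> \<Delta> \<Longrightarrow> subgraph G X \<iota> \<Xi> \<Longrightarrow> gle \<Delta> \<Xi> \<Longrightarrow> gle \<Xi> (clo \<Delta>) \<Longrightarrow> clo \<Xi> = clo \<Delta>"
  by (meson clo_least cyclic_clo gle_antisym gle_clo gle_trans)

lemma clo_eqI:
  "subgraph G X \<iota> \<Delta> \<Longrightarrow> subgraph G X \<iota> \<Xi> \<Longrightarrow> gle \<Delta> (clo \<Xi>) \<Longrightarrow> gle \<Xi> (clo \<Delta>) \<Longrightarrow> clo \<Delta> = clo \<Xi>"
  by (meson clo_least cyclic_clo gle_antisym)

text \<open>The union of the closures lies between \<open>gunion \<Delta> \<Xi>\<close> and its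
  closure, by minimality of the two closures. This is what makes the closure map
  multiplicative.\<close>

lemma clo_gunion:
  assumes "subgraph G X \<iota> \<Delta>" "subgraph G X \<iota> \<Xi>"
  shows "clo (gunion (clo \<Delta>) (clo \<Xi>)) = clo (gunion \<Delta> \<Xi>)"
proof (rule clo_between)
  have "gle \<Delta> (clo (gunion \<Delta> \<Xi>))" "gle \<Xi> (clo (gunion \<Delta> \<Xi>))"
    using assms by (meson gle_clo gle_gunion1 gle_gunion2 gle_trans subgraph_gunion)+
  then show "gle (gunion (clo \<Delta>) (clo \<Xi>)) (clo (gunion \<Delta> \<Xi>))"
    using assms by (simp add: gle_gunion clo_least cyclic_clo subgraph_gunion)
  show "gle (gunion \<Delta> \<Xi>) (gunion (clo \<Delta>) (clo \<Xi>))"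
    using gle_clo[OF assms(1)] gle_clo[OF assms(2)] by (auto simp: gle_def gunion_def)
qed (use assms subgraph_gunion subgraph_clo in auto)

text \<open>A simple cycle meeting the translate is pulled back by \<open>inv k\<close> to a simple
  cycle meeting \<open>\<Delta>\<close>, which lies in \<open>\<Delta>\<close> and is then pushed
  forward again.\<close>

lemma cyclic_translate:
  assumes "cyclic_subgraph G X \<iota> \<Delta>" "k \<in> carrier G"
  shows "cyclic_subgraph G X \<iota> (translate G k \<Delta>)"
  unfolding cyclic_subgraph_def
proof (intro conjI ballI allI impI)
  have s: "subgraph G X \<iota> \<Delta>" using assms(1) by (rule cyclic_subgraph_subgraph)
  show sk: "subgraph G X \<iota> (translate G k \<Delta>)" using s assms(2) by (rule subgraph_translate)
  fix e es
  assume e: "e \<in> edges (translate G k \<Delta>)" and es: "simple_cycle G X \<iota> es \<and> e \<in> set es"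
  have cancel: "etranslate G k (etranslate G (inv k) d) = d" if "d \<in> edges (Cay G X)" for d
    using that assms(2) by (auto simp: etranslate_def Cay_def m_assoc[symmetric])
  have "set es \<subseteq> edges (Cay G X)"
    using es by (meson path_in_edges simple_cycle_def)
  moreover have "etranslate G (inv k) e \<in> edges (translate G (inv k) (translate G k \<Delta>))"
    using e by (simp add: edges_translate)
  then have "set (map (etranslate G (inv k)) es) \<subseteq> edges \<Delta>"
    using simple_cycle_translate[of es "inv k"] es assms(2)
    by (intro cyclic_subgraph_cycle[OF assms(1)]) (auto simp: translate_inv_cancel[OF s])
  then have "etranslate G k ` etranslate G (inv k) ` set es \<subseteq> edges (translate G k \<Delta>)"
    by (auto simp: edges_translate)
  moreover have "etranslate G k ` etranslate G (inv k) ` set es = id ` set es"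
    using calculation(1) cancel unfolding image_image by (intro image_cong) auto
  ultimately show "set es \<subseteq> edges (translate G k \<Delta>)" by simp
qed

text \<open>Minimality of the closure gives one inclusion for every graph and every group element.
  Its instance for \<open>translate G k \<Delta>\<close> and \<open>inv k\<close>, translated by
  \<open>k\<close>, is the other inclusion.\<close>

lemma clo_translate:
  assumes "subgraph G X \<iota> \<Delta>" "k \<in> carrier G"
  shows "clo (translate G k \<Delta>) = translate G k (clo \<Delta>)"
proof (rule gle_antisym)
  have le: "gle (clo (translate G l \<Xi>)) (translate G l (clo \<Xi>))"
    if "subgraph G X \<iota> \<Xi>" "l \<in> carrier G" for l \<Xi>
    using that by (intro clo_least subgraph_translate cyclic_translate cyclic_clo gle_translate gle_clo)
  then show "gle (clo (translate G k \<Delta>)) (translate G k (clo \<Delta>))"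
    using assms by blast
  have "gle (clo \<Delta>) (translate G (inv k) (clo (translate G k \<Delta>)))"
    using le[of "translate G k \<Delta>" "inv k"] assms
    by (simp add: subgraph_translate translate_inv_cancel)
  then show "gle (translate G k (clo \<Delta>)) (clo (translate G k \<Delta>))"
    using gle_translate[of "clo \<Delta>" _ G k] assms
    by (metis subgraph_clo subgraph_translate translate_inv_cancel(1))
qed

text \<open>The part of the closure that is reachable from a vertex of \<open>\<Delta>\<close> is itself cyclic and
  contains \<open>\<Delta>\<close>.\<close>

lemma connected_graph_clo:
  assumes s: "subgraph G X \<iota> \<Delta>" and c: "connected_graph G \<iota> \<Delta>"
  shows "connected_graph G \<iota> (clo \<Delta>)"
proof (cases "verts \<Delta> = {}")
  case True
  then have "edges \<Delta> = {}" using subgraph_edge(1)[OF s] by auto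
  then show ?thesis using clo_cyclic[OF cyclic_no_edges[OF s]] c by simp
next
  case False
  then obtain k where k: "k \<in> verts \<Delta>" by blast
  define V where "V = {v. \<exists>es. path_in G \<iota> (clo \<Delta>) k es v}"
  define K where "K = \<lparr>verts = V, edges = {e \<in> edges (clo \<Delta>). src e \<in> V}\<rparr>"
  have sc: "subgraph G X \<iota> (clo \<Delta>)" using s by (rule subgraph_clo)
  have step: "w \<in> V" if "v \<in> V" "path_in G \<iota> (clo \<Delta>) v es w" for v es w
    using that unfolding V_def mem_Collect_eq by (blast intro: path_in_append[THEN iffD2])
  have tgt: "tgt G \<iota> e \<in> V" if "e \<in> edges (clo \<Delta>)" "src e \<in> V" for e
    using step[OF that(2), of "[e]"] that(1) subgraph_edge[OF sc] by simp
  have "subgraph G X \<iota> K"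
    unfolding subgraph_def
  proof (intro conjI ballI)
    show "verts K \<subseteq> verts (Cay G X)"
      using path_in_end subgraph_vert[OF sc] by (fastforce simp: K_def V_def Cay_def)
    show "edges K \<subseteq> edges (Cay G X)"
      using subgraph_edge_Cay[OF sc] unfolding K_def by fastforce
    fix e
    assume "e \<in> edges K"
    then have e: "e \<in> edges (clo \<Delta>)" "src e \<in> V" by (auto simp: K_def)
    then show "src e \<in> verts K" "tgt G \<iota> e \<in> verts K" "einv G \<iota> e \<in> edges K"
      using tgt[OF e] subgraph_edge(3)[OF sc e(1)] Cay_edge(4)[OF subgraph_edge_Cay[OF sc e(1)]]
      by (auto simp: K_def)
  qed
  moreover have "set es \<subseteq> edges K"
    if e: "e \<in> edges K" and es: "simple_cycle G X \<iota> es" "e \<in> set es" for e es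
  proof -
    have sub: "set es \<subseteq> edges (clo \<Delta>)"
      using e by (intro cyclic_subgraph_cycle[OF cyclic_clo[OF s] es(1) _ es(2)]) (simp add: K_def)
    obtain g where g: "path_in G \<iota> (Cay G X) g es g"
      using es by (auto simp: simple_cycle_def)
    have "g \<in> verts (clo \<Delta>)"
      using g sub es(2) subgraph_edge(1)[OF sc] by (cases es) auto
    then have p: "path_in G \<iota> (clo \<Delta>) g es g"
      using path_in_subgraph[OF sc g sub] by blast
    have pre: "\<exists>ys. path_in G \<iota> (clo \<Delta>) g ys (src f)" if "f \<in> set es" for f
      using that by (intro path_in_prefix[OF p]) (simp add: path_verts_eq_src[OF p])
    \<comment> \<open>The base point of the cycle is reached from the source of \<open>e\<close> by
      reversing an initial piece of the cycle; from the base point all other sources on the cycle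
      are reachable.\<close>
    have "g \<in> V"
    proof -
      obtain ys where "path_in G \<iota> (clo \<Delta>) g ys (src e)"
        using pre[OF es(2)] by blast
      from step[OF _ path_in_reverse[OF sc this]] show ?thesis
        using e by (simp add: K_def)
    qed
    then have "src f \<in> V" if "f \<in> set es" for f
      using pre[OF that] step by blast
    then show ?thesis using sub by (auto simp: K_def)
  qed
  ultimately have "cyclic_subgraph G X \<iota> K"
    unfolding cyclic_subgraph_def by blast
  moreover have "verts \<Delta> \<subseteq> V"
    using c k path_in_mono[OF _ gle_clo[OF s]] unfolding connected_graph_def V_def by blast
  then have "gle \<Delta> K"
    using gle_clo[OF s] subgraph_edge(1)[OF s] by (auto simp: gle_def K_def)
  ultimately have "gle (clo \<Delta>) K" using clo_least[OF s] by blast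
  then show ?thesis
    by (intro connected_graph_root[OF sc, of k]) (auto simp: gle_def K_def V_def)
qed

text \<open>The path is cut at its first vertex in \<open>V\<close>: all edges before the cut start
  outside \<open>V\<close>. The segment \<open>xs\<close> is empty exactly when the path starts in
  \<open>V\<close>.\<close>

lemma path_in_first_hit:
  "path_in G \<iota> \<Delta> u es v \<Longrightarrow> v \<in> V \<Longrightarrow>
   \<exists>xs ys w. es = xs @ ys \<and> path_in G \<iota> \<Delta> u xs w \<and> path_in G \<iota> \<Delta> w ys v \<and> w \<in> V \<and>
     src ` set xs \<inter> V = {}"
proof (induction es arbitrary: u)
  case Nil
  then show ?case by (auto intro!: exI[of _ "[]"])
next
  case (Cons e es)
  show ?case
  proof (cases "u \<in> V")
    case True
    with Cons.prems show ?thesis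
      by (intro exI[of _ "[]"] exI[of _ "e # es"] exI[of _ u]) auto
  next
    case False
    from Cons.prems have "path_in G \<iota> \<Delta> (tgt G \<iota> e) es v" by simp
    from Cons.IH[OF this Cons.prems(2)] obtain xs ys w where "es = xs @ ys" "path_in G \<iota> \<Delta> (tgt G \<iota> e) xs w"
      "path_in G \<iota> \<Delta> w ys v" "w \<in> V" "src ` set xs \<inter> V = {}"
      by blast
    with False Cons.prems show ?thesis
      by (intro exI[of _ "e # xs"] exI[of _ ys] exI[of _ w]) auto
  qed
qed

text \<open>An initial segment of the path up to its first return to \<open>\<Delta>\<close> closes up with a simple path
  in \<open>\<Delta>\<close> to a simple cycle.\<close>

lemma simple_path_in_cyclic:
  assumes cyc: "cyclic_subgraph G X \<iota> \<Delta>" and con: "connected_graph G \<iota> \<Delta>"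
    and v: "v \<in> verts \<Delta>"
  shows "u \<in> verts \<Delta> \<Longrightarrow> simple_path G X \<iota> u es v \<Longrightarrow> set es \<subseteq> edges \<Delta>"
proof (induction "length es" arbitrary: es u rule: less_induct)
  case less
  note s = cyclic_subgraph_subgraph[OF cyc]
  have p: "path_in G \<iota> (Cay G X) u es v"
    using less.prems by (simp add: simple_path_def)
  have d: "distinct (map src es @ [v])"
    using less.prems path_verts_eq_src[OF p] by (simp add: simple_path_def)
  show ?case
  proof (cases es)
    case (Cons e es')
    then have e: "src e = u" "path_in G \<iota> (Cay G X) (tgt G \<iota> e) es' v"
      "e \<in> edges (Cay G X)" "u \<in> verts (Cay G X)"
      using p by auto
    obtain xs ys w where xs: "es' = xs @ ys" "path_in G \<iota> (Cay G X) (tgt G \<iota> e) xs w"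
      \<comment> \<open>The search for the first return begins after the edge \<open>e\<close>,
        because the initial vertex \<open>u\<close> already lies in \<open>\<Delta>\<close>.\<close>
      "path_in G \<iota> (Cay G X) w ys v" "w \<in> verts \<Delta>" "src ` set xs \<inter> verts \<Delta> = {}"
      using path_in_first_hit[OF e(2) v] by blast
    have w: "map src ys @ [v] = path_verts G \<iota> w ys"
      by (rule path_verts_eq_src[OF xs(3), symmetric])
    then have "w \<noteq> u"
      using d by (cases ys) (auto simp: Cons xs(1) e(1) path_verts_def)
    obtain r where r: "path_in G \<iota> \<Delta> w r u" "distinct (path_verts G \<iota> w r)"
      using con xs(4) less.prems(1) ex_simple_path unfolding connected_graph_def by metis
    have r': "distinct (map src r @ [u])"
      using r(2) by (simp add: path_verts_eq_src[OF r(1)])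
    have r_in: "set r \<subseteq> edges \<Delta>" using r(1) by (rule path_in_edges)
    have "path_in G \<iota> (Cay G X) u ((e # xs) @ r) u"
      using e xs(2) path_in_mono[OF r(1) subgraph_gle_Cay[OF s]] by (auto simp: path_in_append)
    moreover have "src ` set r \<subseteq> verts \<Delta>"
      using r_in subgraph_edge(1)[OF s] by blast
    \<comment> \<open>The sources of \<open>xs\<close> lie outside \<open>\<Delta>\<close> and those
      of \<open>r\<close> inside, so these cannot meet. The vertex \<open>u\<close> is the end of
      the simple path \<open>r\<close>, hence not one of its sources.\<close>
    then have "distinct (map src ((e # xs) @ r))"
      using d r' xs(5) by (auto simp: Cons xs(1) e(1))
    ultimately have cycle: "simple_cycle G X \<iota> ((e # xs) @ r)"
      by (auto simp: simple_cycle_def)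
    \<comment> \<open>Cyclicity applies only to a cycle already sharing an edge with
      \<open>\<Delta>\<close>; as \<open>w\<close> differs from \<open>u\<close>, the first edge of
      \<open>r\<close> is such an edge.\<close>
    have "r \<noteq> []" using r(1) \<open>w \<noteq> u\<close> by auto
    then have "set ((e # xs) @ r) \<subseteq> edges \<Delta>"
      using r_in by (intro cyclic_subgraph_cycle[OF cyc cycle, of "hd r"]) auto
    moreover have "simple_path G X \<iota> w ys v"
      using d xs(3) by (simp add: simple_path_def Cons xs(1) flip: w)
    \<comment> \<open>The remaining path starts at the vertex \<open>w\<close> of
      \<open>\<Delta>\<close> and is shorter by at least the edge \<open>e\<close>.\<close>
    then have "set ys \<subseteq> edges \<Delta>"
      using xs(4) by (intro less.hyps) (simp_all add: Cons xs(1))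
    ultimately show ?thesis by (simp add: Cons xs(1))
  qed simp
qed

text \<open>The closure of the graph spanned by \<open>p\<close> is connected, cyclic and contains
  both ends of \<open>q\<close>, so it contains all of \<open>q\<close>.\<close>

lemma gle_clo_spanned:
  assumes p: "simple_path G X \<iota> u p v" and q: "simple_path G X \<iota> u q v"
  shows "gle (spanned G \<iota> u q) (clo (spanned G \<iota> u p))"
proof -
  have pp: "path_in G \<iota> (Cay G X) u p v" and qq: "path_in G \<iota> (Cay G X) u q v"
    using p q by (auto simp: simple_path_def)
  let ?C = "clo (spanned G \<iota> u p)"
  note s = subgraph_spanned[OF pp]
  note c = path_in_mono[OF path_in_spanned[OF pp] gle_clo[OF s]]
  have "set q \<subseteq> edges ?C"
    by (rule simple_path_in_cyclic[OF cyclic_clo[OF s]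
        connected_graph_clo[OF s connected_graph_spanned[OF pp]] path_in_end[OF c] path_in_start[OF c] q])
  from path_in_subgraph[OF subgraph_clo[OF s] qq this path_in_start[OF c]]
  show ?thesis by (rule gle_spanned[OF subgraph_clo[OF s]])
qed

lemma clo_spanned_eq:
  assumes p: "simple_path G X \<iota> u p v" and q: "simple_path G X \<iota> u q v"
  shows "clo (spanned G \<iota> u p) = clo (spanned G \<iota> u q)"
proof (rule clo_eqI)
  show "subgraph G X \<iota> (spanned G \<iota> u p)" "subgraph G X \<iota> (spanned G \<iota> u q)"
    using p q unfolding simple_path_def by (blast intro: subgraph_spanned)+
qed (fact gle_clo_spanned[OF q p] gle_clo_spanned[OF p q])+


section \<open>The projection of the Margolis--Meakin expansion onto compact subgraphs\<close>

abbreviation MMG :: "(('g, 'x) graph \<times> 'g) inv_monoid" where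
  "MMG \<equiv> MM G X \<iota>"

lemma MM_mem:
  "(\<Gamma>, g) \<in> carrier MMG \<longleftrightarrow>
     subgraph G X \<iota> \<Gamma> \<and> finite_graph \<Gamma> \<and> connected_graph G \<iota> \<Gamma> \<and> \<one> \<in> verts \<Gamma> \<and> g \<in> verts \<Gamma>"
  by (simp add: MM_def)

lemma MM_mult: "(\<Delta>, g) \<otimes>\<^bsub>MMG\<^esub> (\<Xi>, h) = (gunion \<Delta> (translate G g \<Xi>), g \<otimes> h)"
  by (simp add: MM_def)

lemma MM_minv: "minv MMG (\<Delta>, g) = (translate G (inv g) \<Delta>, inv g)"
  by (simp add: MM_def)

lemma MM_memD:
  assumes "(\<Gamma>, g) \<in> carrier MMG"
  shows "subgraph G X \<iota> \<Gamma>" "finite_graph \<Gamma>" "connected_graph G \<iota> \<Gamma>" "\<one> \<in> verts \<Gamma>"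
    "g \<in> verts \<Gamma>" "g \<in> carrier G"
  using assms subgraph_vert by (auto simp: MM_mem)

lemma subgraph_trivial: "subgraph G X \<iota> (trivial_graph G)"
  by (simp add: trivial_graph_def subgraph_def Cay_def)

lemma clo_trivial: "clo (trivial_graph G) = trivial_graph G"
  by (intro clo_cyclic cyclic_no_edges subgraph_trivial) (simp add: trivial_graph_def)

lemma MM_one_closed: "\<one>\<^bsub>MMG\<^esub> \<in> carrier MMG"
proof -
  have "connected_graph G \<iota> (trivial_graph G)"
    unfolding connected_graph_def trivial_graph_def by (auto intro: exI[of _ "[]"])
  then show ?thesis
    using subgraph_trivial by (simp add: MM_def) (simp add: trivial_graph_def finite_graph_def)
qed

text \<open>The two graphs of the product share the vertex \<open>g\<close>, as \<open>\<Xi>\<close>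
  contains \<open>\<one>\<close>; hence their union is connected.\<close>

lemma MM_mult_closed:
  assumes "a \<in> carrier MMG" "b \<in> carrier MMG"
  shows "a \<otimes>\<^bsub>MMG\<^esub> b \<in> carrier MMG"
proof -
  obtain \<Delta> g \<Xi> h where ab: "a = (\<Delta>, g)" "b = (\<Xi>, h)" by (cases a, cases b)
  note \<Delta> = MM_memD[OF assms(1)[unfolded ab(1)]]
  note \<Xi> = MM_memD[OF assms(2)[unfolded ab(2)]]
  have gg: "g \<in> verts (translate G g \<Xi>)"
    using \<Xi>(4) \<Delta>(6) by (force simp: verts_translate)
  have gh: "g \<otimes> h \<in> verts (translate G g \<Xi>)"
    using \<Xi>(5) by (simp add: verts_translate)
  have "connected_graph G \<iota> (gunion \<Delta> (translate G g \<Xi>))"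
    using \<Delta> \<Xi> gg by (intro connected_graph_gunion connected_graph_translate subgraph_translate)
  then show ?thesis
    using \<Delta> \<Xi> gh unfolding ab MM_mult MM_mem
    by (auto intro: subgraph_gunion subgraph_translate finite_graph_gunion finite_graph_translate
        simp: verts_gunion)
qed

lemma MM_minv_closed:
  assumes "a \<in> carrier MMG"
  shows "minv MMG a \<in> carrier MMG"
proof -
  obtain \<Delta> g where a: "a = (\<Delta>, g)" by (cases a)
  note \<Delta> = MM_memD[OF assms(1)[unfolded a]]
  have "\<one> \<in> verts (translate G (inv g) \<Delta>)" "inv g \<in> verts (translate G (inv g) \<Delta>)"
    using \<Delta>(4,5,6) by (force simp: verts_translate)+
  then show ?thesis
    using \<Delta> unfolding a MM_minv MM_mem
    by (auto intro: subgraph_translate finite_graph_translate connected_graph_translate)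
qed

definition proj :: "('g, 'x) graph \<times> 'g \<Rightarrow> ('g, 'x) graph \<times> 'g" where
  "proj = (\<lambda>(\<Gamma>, g). (clo \<Gamma>, g))"

lemma proj_mult:
  assumes "a \<in> carrier MMG" "b \<in> carrier MMG"
  shows "proj (a \<otimes>\<^bsub>MMG\<^esub> b) = proj a \<otimes>\<^bsub>S_circ G X \<iota>\<^esub> proj b"
proof -
  obtain \<Delta> g \<Xi> h where ab: "a = (\<Delta>, g)" "b = (\<Xi>, h)" by (cases a, cases b)
  note \<Delta> = MM_memD[OF assms(1)[unfolded ab(1)]]
  note \<Xi> = MM_memD[OF assms(2)[unfolded ab(2)]]
  have "clo (gunion \<Delta> (translate G g \<Xi>)) = clo (gunion (clo \<Delta>) (translate G g (clo \<Xi>)))"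
    using \<Delta> \<Xi> by (simp add: clo_gunion subgraph_translate flip: clo_translate)
  then show ?thesis by (simp add: ab MM_mult proj_def S_circ_def)
qed

lemma proj_one: "proj \<one>\<^bsub>MMG\<^esub> = \<one>\<^bsub>S_circ G X \<iota>\<^esub>"
  by (simp add: MM_def S_circ_def proj_def clo_trivial)

lemma proj_minv:
  assumes "a \<in> carrier MMG"
  shows "proj (minv MMG a) = minv (S_circ G X \<iota>) (proj a)"
proof -
  obtain \<Delta> g where a: "a = (\<Delta>, g)" by (cases a)
  note \<Delta> = MM_memD[OF assms(1)[unfolded a]]
  show ?thesis using \<Delta> by (simp add: a MM_minv proj_def S_circ_def clo_translate)
qed

text \<open>A finite connected graph with compact closure \<open>\<Delta>\<close> need not contain \<open>\<one>\<close> and \<open>g\<close>; it is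
  enlarged by paths inside \<open>\<Delta>\<close>.\<close>

lemma proj_surj: "proj ` carrier MMG = carrier (S_circ G X \<iota>)"
proof (rule equalityI; rule subsetI)
  fix b
  assume "b \<in> proj ` carrier MMG"
  then obtain \<Gamma> g where \<Gamma>: "(\<Gamma>, g) \<in> carrier MMG" and b: "b = (clo \<Gamma>, g)"
    by (auto simp: proj_def)
  note \<Gamma>' = MM_memD[OF \<Gamma>]
  have "compact_subgraph G X \<iota> (clo \<Gamma>)"
    using \<Gamma>' by (auto simp: compact_subgraph_def)
  then show "b \<in> carrier (S_circ G X \<iota>)"
    using \<Gamma>' gle_clo[OF \<Gamma>'(1)] connected_graph_clo by (auto simp: b S_circ_def gle_def)
next
  fix b
  assume "b \<in> carrier (S_circ G X \<iota>)"
  then obtain \<Delta> g F where b: "b = (\<Delta>, g)" and \<Delta>: "connected_graph G \<iota> \<Delta>" "\<one> \<in> verts \<Delta>"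
    "g \<in> verts \<Delta>" and F: "subgraph G X \<iota> F" "finite_graph F" "connected_graph G \<iota> F" "\<Delta> = clo F"
    by (auto simp: S_circ_def compact_subgraph_def)
  \<comment> \<open>An empty \<open>F\<close> would be its own closure, while
    \<open>\<Delta>\<close> contains \<open>\<one>\<close>.\<close>
  have "verts F \<noteq> {}"
  proof
    assume e: "verts F = {}"
    then have "edges F = {}" using subgraph_edge(1)[OF F(1)] by auto
    then have "\<Delta> = F" using clo_cyclic[OF cyclic_no_edges[OF F(1)]] F(4) by simp
    then show False using e \<Delta>(2) by simp
  qed
  then obtain k where k: "k \<in> verts F" by blast
  then have "k \<in> verts \<Delta>" using gle_clo[OF F(1)] by (auto simp: F(4) gle_def)
  then obtain p q where p: "path_in G \<iota> \<Delta> k p \<one>" and q: "path_in G \<iota> \<Delta> k q g"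
    using \<Delta> unfolding connected_graph_def by blast
  have s\<Delta>: "subgraph G X \<iota> \<Delta>" using subgraph_clo F by simp
  note pC = path_in_mono[OF p subgraph_gle_Cay[OF s\<Delta>]]
  note qC = path_in_mono[OF q subgraph_gle_Cay[OF s\<Delta>]]
  define P where "P = spanned G \<iota> k p"
  define Q where "Q = spanned G \<iota> k q"
  have P: "subgraph G X \<iota> P" "finite_graph P" "connected_graph G \<iota> P" "k \<in> verts P" "\<one> \<in> verts P"
    "gle P \<Delta>"
    using subgraph_spanned[OF pC] connected_graph_spanned[OF pC] gle_spanned[OF s\<Delta> p]
      path_in_start[OF path_in_spanned[OF pC]] path_in_end[OF path_in_spanned[OF pC]]
    by (simp_all add: P_def finite_graph_spanned)
  have Q: "subgraph G X \<iota> Q" "finite_graph Q" "connected_graph G \<iota> Q" "k \<in> verts Q" "g \<in> verts Q"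
    "gle Q \<Delta>"
    using subgraph_spanned[OF qC] connected_graph_spanned[OF qC] gle_spanned[OF s\<Delta> q]
      path_in_start[OF path_in_spanned[OF qC]] path_in_end[OF path_in_spanned[OF qC]]
    by (simp_all add: Q_def finite_graph_spanned)
  define \<Gamma> where "\<Gamma> = gunion F (gunion P Q)"
  have s\<Gamma>: "subgraph G X \<iota> \<Gamma>"
    using F P Q by (simp add: \<Gamma>_def subgraph_gunion)
  have "connected_graph G \<iota> (gunion P Q)"
    using P Q by (intro connected_graph_gunion)
  then have "connected_graph G \<iota> \<Gamma>"
    unfolding \<Gamma>_def using F P Q k
    by (intro connected_graph_gunion[of _ _ k] subgraph_gunion) (auto simp: gunion_def)
  then have "(\<Gamma>, g) \<in> carrier MMG"
    using s\<Gamma> P(5) Q(5) F(2) P(2) Q(2)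
    by (simp add: MM_mem finite_graph_gunion \<Gamma>_def) (simp add: gunion_def)
  moreover have "clo \<Gamma> = clo F"
    \<comment> \<open>The added paths run inside \<open>\<Delta>\<close>, so \<open>\<Gamma>\<close>
      lies between \<open>F\<close> and the closure of \<open>F\<close>.\<close>
    using F(1) s\<Gamma> P(6) Q(6) gle_clo[OF F(1)]
    by (intro clo_between) (simp_all add: \<Gamma>_def gle_gunion gle_gunion1 F(4))
  ultimately show "b \<in> proj ` carrier MMG"
    by (force simp: b F(4) proj_def)
qed


section \<open>The kernel of the projection\<close>

abbreviation xiG :: "((('g, 'x) graph \<times> 'g) \<times> (('g, 'x) graph \<times> 'g)) set" where
  "xiG \<equiv> xi G X \<iota>"

lemma spanned_MM:
  assumes "simple_path G X \<iota> \<one> p g"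
  shows "(spanned G \<iota> \<one> p, g) \<in> carrier MMG"
proof -
  have p: "path_in G \<iota> (Cay G X) \<one> p g" using assms by (simp add: simple_path_def)
  show ?thesis
    using subgraph_spanned[OF p] connected_graph_spanned[OF p]
      path_in_start[OF path_in_spanned[OF p]] path_in_end[OF path_in_spanned[OF p]]
    by (simp add: MM_mem finite_graph_spanned)
qed

text \<open>The kernel of \<open>proj\<close> is a congruence, and it contains the generating pairs
  because simple paths with common ends have the same closure. Both claims follow from this one
  congruence.\<close>

lemma xi_congruence: "congruence MMG xiG"
  and xi_proj: "(a, b) \<in> xiG \<Longrightarrow> proj a = proj b"
proof -
  let ?R = "{((spanned G \<iota> \<one> p, g), (spanned G \<iota> \<one> q, g)) | p q g.
        g \<in> carrier G \<and> simple_path G X \<iota> \<one> p g \<and> simple_path G X \<iota> \<one> q g}"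
  let ?K = "{(a, b). a \<in> carrier MMG \<and> b \<in> carrier MMG \<and> proj a = proj b}"
  have K: "congruence MMG ?K"
    by (rule congruence_kernel[where N = "S_circ G X \<iota>"])
      (simp_all add: MM_mult_closed MM_minv_closed proj_mult proj_minv)
  have R: "?R \<subseteq> ?K"
  proof
    fix z
    assume "z \<in> ?R"
    then obtain p q g where z: "z = ((spanned G \<iota> \<one> p, g), (spanned G \<iota> \<one> q, g))"
      and p: "simple_path G X \<iota> \<one> p g" and q: "simple_path G X \<iota> \<one> q g" by blast
    show "z \<in> ?K"
      using spanned_MM[OF p] spanned_MM[OF q] clo_spanned_eq[OF p q] by (simp add: z proj_def)
  qed
  show "congruence MMG xiG"
    unfolding xi_def using K R by (rule congruence_gen_congruence)
  have "xiG \<subseteq> ?K"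
    unfolding xi_def using K R by (rule congruence_gen_least)
  then show "(a, b) \<in> xiG \<Longrightarrow> proj a = proj b" by blast
qed

lemma xi_simple_paths:
  assumes p: "simple_path G X \<iota> \<one> p g" and q: "simple_path G X \<iota> \<one> q g"
  shows "((spanned G \<iota> \<one> p, g), (spanned G \<iota> \<one> q, g)) \<in> xiG"
proof -
  have "g \<in> carrier G" using MM_memD(6)[OF spanned_MM[OF p]] .
  then show ?thesis
    unfolding xi_def using p q by (intro subsetD[OF congruence_gen_superset] CollectI) blast
qed

section \<open>Calculation rules for the congruence\<close>

lemma xi_equiv: "equiv (carrier MMG) xiG"
  using xi_congruence by (simp add: congruence_def)

lemma xi_mem: "(a, b) \<in> xiG \<Longrightarrow> a \<in> carrier MMG \<and> b \<in> carrier MMG"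
  using equiv_type[OF xi_equiv] by auto

lemma xi_refl: "a \<in> carrier MMG \<Longrightarrow> (a, a) \<in> xiG"
  using xi_equiv by (auto simp: equiv_def refl_on_def)

lemma xi_sym: "(a, b) \<in> xiG \<Longrightarrow> (b, a) \<in> xiG"
  using xi_equiv by (auto simp: equiv_def dest: symD)

lemma xi_trans: "(a, b) \<in> xiG \<Longrightarrow> (b, c) \<in> xiG \<Longrightarrow> (a, c) \<in> xiG"
  using xi_equiv by (auto simp: equiv_def dest: transD)

lemma xi_mult: "(a, a') \<in> xiG \<Longrightarrow> (b, b') \<in> xiG \<Longrightarrow> (a \<otimes>\<^bsub>MMG\<^esub> b, a' \<otimes>\<^bsub>MMG\<^esub> b') \<in> xiG"
  using xi_congruence by (auto simp: congruence_def)

text \<open>Multiply the given pair by \<open>(\<Gamma>, v)\<close> on the left and by the translate of \<open>\<Gamma>\<close> based at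
  \<open>v \<otimes> h\<close> on the right.\<close>

lemma xi_join:
  assumes AB: "((A, h), (B, h)) \<in> xiG" and \<Gamma>: "(\<Gamma>, g) \<in> carrier MMG"
    and v: "v \<in> verts \<Gamma>" "v \<otimes> h \<in> verts \<Gamma>"
  shows "((gunion \<Gamma> (translate G v A), g), (gunion \<Gamma> (translate G v B), g)) \<in> xiG"
proof -
  note \<Gamma>' = MM_memD[OF \<Gamma>]
  have h: "h \<in> carrier G" using xi_mem[OF AB] MM_memD(6) by blast
  have vG: "v \<in> carrier G" using v(1) \<Gamma>'(1) subgraph_vert by blast
  define u where "u = v \<otimes> h"
  have u: "u \<in> carrier G" "u \<in> verts \<Gamma>" using v(2) vG h by (auto simp: u_def)
  have l: "(\<Gamma>, v) \<in> carrier MMG" using \<Gamma> v(1) by (simp add: MM_mem)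
  have "\<one> \<in> verts (translate G (inv u) \<Gamma>)" "inv u \<otimes> g \<in> verts (translate G (inv u) \<Gamma>)"
    using u \<Gamma>'(5) by (force simp: verts_translate)+
  then have r: "(translate G (inv u) \<Gamma>, inv u \<otimes> g) \<in> carrier MMG"
    using \<Gamma>' u(1)
    by (simp add: MM_mem subgraph_translate finite_graph_translate connected_graph_translate)
  \<comment> \<open>The first product has group component \<open>u\<close>, which moves the graph of
    the right factor back onto \<open>\<Gamma>\<close> and turns its group component into
    \<open>g\<close>.\<close>
  have "(\<Gamma>, v) \<otimes>\<^bsub>MMG\<^esub> (C, h) \<otimes>\<^bsub>MMG\<^esub> (translate G (inv u) \<Gamma>, inv u \<otimes> g)
      = (gunion \<Gamma> (translate G v C), g)" for C
  proof -
    have "u \<otimes> (inv u \<otimes> g) = g" using u \<Gamma>'(6) by (simp flip: m_assoc)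
    moreover have "gunion (gunion \<Gamma> (translate G v C)) \<Gamma> = gunion \<Gamma> (translate G v C)"
      by (auto simp: gunion_def)
    ultimately show ?thesis
      using u \<Gamma>'(1) by (simp add: MM_mult translate_inv_cancel flip: u_def)
  qed
  then show ?thesis
    using xi_mult[OF xi_mult[OF xi_refl[OF l] AB] xi_refl[OF r]] by simp
qed

text \<open>This is the preceding join with base point \<open>v = \<one>\<close>, where the
  translations disappear.\<close>

lemma xi_gunion:
  assumes "((A, g), (B, g)) \<in> xiG" "(\<Gamma>, g) \<in> carrier MMG"
  shows "((gunion \<Gamma> A, g), (gunion \<Gamma> B, g)) \<in> xiG"
proof -
  have "translate G \<one> A = A" "translate G \<one> B = B"
    using xi_mem[OF assms(1)] by (auto simp: MM_mem translate_one)
  then show ?thesis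
    using xi_join[OF assms, of \<one>] MM_memD[OF assms(2)] by simp
qed

text \<open>The rest of a simple cycle through \<open>e\<close> is a simple path between the same vertices as the
  inverse of \<open>e\<close>.\<close>

lemma xi_add_cycle:
  assumes \<Gamma>: "(\<Gamma>, g) \<in> carrier MMG" and e: "e \<in> edges \<Gamma>"
    and es: "simple_cycle G X \<iota> es" "e \<in> set es"
  shows "\<exists>\<Gamma>'. ((\<Gamma>', g), (\<Gamma>, g)) \<in> xiG \<and> set es \<subseteq> edges \<Gamma>'"
proof -
  note \<Gamma>' = MM_memD[OF \<Gamma>]
  obtain k where k: "path_in G \<iota> (Cay G X) k es k" and d: "distinct (map src es)"
    using es(1) by (auto simp: simple_cycle_def)
  obtain xs ys where es_eq: "es = xs @ e # ys"
    using es(2) by (meson split_list)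
  define u where "u = src e"
  define v where "v = tgt G \<iota> e"
  define c where "c = ys @ xs"
  have uv: "u \<in> verts \<Gamma>" "v \<in> verts \<Gamma>" "einv G \<iota> e \<in> edges \<Gamma>"
    using subgraph_edge[OF \<Gamma>'(1) e] by (auto simp: u_def v_def)
  then have uvG: "u \<in> carrier G" "v \<in> carrier G"
    using subgraph_vert[OF \<Gamma>'(1)] by auto
  \<comment> \<open>The cycle is rotated at its base point, so that it runs from the target of
    \<open>e\<close> through \<open>ys\<close> and then \<open>xs\<close> back to the source of
    \<open>e\<close>.\<close>
  have c: "path_in G \<iota> (Cay G X) v c u"
    using k by (auto simp: es_eq path_in_append u_def v_def c_def)
  have dc: "distinct (map src c @ [u])"
    using d by (auto simp: es_eq c_def u_def)
  then have simple_c: "simple_path G X \<iota> v c u"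
    using c path_verts_eq_src[OF c] by (simp add: simple_path_def)
  show ?thesis
  proof (cases "u = v")
    case True
    \<comment> \<open>If \<open>e\<close> is a loop, a nonempty \<open>c\<close> would start at
      \<open>v = u\<close> and repeat a vertex; so the cycle consists of \<open>e\<close> alone and
      \<open>\<Gamma>\<close> itself is a witness.\<close>
    then have "c = []"
      using c dc by (cases c) auto
    then show ?thesis
      using e xi_refl[OF \<Gamma>] by (auto simp: es_eq c_def)
  next
    case False
    note eC = subgraph_edge_Cay[OF \<Gamma>'(1) e]
    \<comment> \<open>The generating pairs of the congruence consist of paths from
      \<open>\<one>\<close>. Both paths from \<open>v\<close> to \<open>u\<close> are therefore
      moved by \<open>inv v\<close>, which sends their common end to \<open>h\<close>.\<close>
    define h where "h = inv v \<otimes> u"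
    have h: "h \<in> carrier G" "v \<otimes> h = u"
      using uvG by (auto simp: h_def simp flip: m_assoc)
    have i: "path_in G \<iota> \<Gamma> v [einv G \<iota> e] u"
      using uv Cay_edge(4,5)[OF eC] by (simp add: u_def v_def)
    have simple_i: "simple_path G X \<iota> v [einv G \<iota> e] u"
      using path_in_mono[OF i subgraph_gle_Cay[OF \<Gamma>'(1)]] False Cay_edge(5)[OF eC]
      by (auto simp: simple_path_def path_verts_def u_def)
    define T where "T = (\<lambda>p. spanned G \<iota> \<one> (map (etranslate G (inv v)) p))"
    have T: "simple_path G X \<iota> \<one> (map (etranslate G (inv v)) p) h \<and>
        translate G v (T p) = spanned G \<iota> v p" if "simple_path G X \<iota> v p u" for p
    proof
      show "simple_path G X \<iota> \<one> (map (etranslate G (inv v)) p) h"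
        using simple_path_translate[OF that, of "inv v"] uvG by (simp add: h_def)
      have p: "path_in G \<iota> (Cay G X) v p u"
        using that by (simp add: simple_path_def)
      have "T p = translate G (inv v) (spanned G \<iota> v p)"
        using spanned_translate[OF p, of "inv v"] uvG by (simp add: T_def)
      then show "translate G v (T p) = spanned G \<iota> v p"
        using uvG by (simp add: translate_inv_cancel subgraph_spanned[OF p])
    qed
    have "((T c, h), (T [einv G \<iota> e], h)) \<in> xiG"
      unfolding T_def using T[OF simple_c] T[OF simple_i] by (intro xi_simple_paths) blast+
    from xi_join[OF this \<Gamma> uv(2)]
    have "((gunion \<Gamma> (spanned G \<iota> v c), g), (gunion \<Gamma> (spanned G \<iota> v [einv G \<iota> e]), g)) \<in> xiG"
      using T[OF simple_c] T[OF simple_i] h uv by simp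
    moreover have "gunion \<Gamma> (spanned G \<iota> v [einv G \<iota> e]) = \<Gamma>"
      using gunion_absorb[OF gle_spanned[OF \<Gamma>'(1) i]] by (simp add: gunion_commute)
    \<comment> \<open>The witness is \<open>\<Gamma>\<close> enlarged by the path \<open>c\<close>:
      the edge \<open>e\<close> comes from \<open>\<Gamma>\<close>, all other edges of the cycle
      from \<open>c\<close>.\<close>
    moreover have "set es \<subseteq> edges (gunion \<Gamma> (spanned G \<iota> v c))"
      using e by (auto simp: es_eq c_def gunion_def spanned_def)
    ultimately show ?thesis by metis
  qed
qed

text \<open>The union of all graphs that are \<open>\<xi>\<close>-related to \<open>\<Gamma>\<close> over \<open>g\<close> is directed and cyclic, so a
  finite subgraph of the cyclic closure of \<open>\<Gamma>\<close> lies in one of them.\<close>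

lemma xi_absorb:
  assumes \<Gamma>: "(\<Gamma>, g) \<in> carrier MMG" and \<Delta>: "(\<Delta>, g) \<in> carrier MMG" and le: "gle \<Delta> (clo \<Gamma>)"
  shows "((gunion \<Delta> \<Gamma>, g), (\<Gamma>, g)) \<in> xiG"
proof -
  note \<Gamma>' = MM_memD[OF \<Gamma>]
  define R where "R = {\<Theta>. ((\<Theta>, g), (\<Gamma>, g)) \<in> xiG}"
  define U where "U = \<lparr>verts = (\<Union>\<Theta>\<in>R. verts \<Theta>), edges = (\<Union>\<Theta>\<in>R. edges \<Theta>)\<rparr>"
  have RM: "(\<Theta>, g) \<in> carrier MMG" if "\<Theta> \<in> R" for \<Theta>
    using that xi_mem by (auto simp: R_def)
  note Rs = MM_memD(1)[OF RM]
  have \<Gamma>R: "\<Gamma> \<in> R" using xi_refl[OF \<Gamma>] by (simp add: R_def)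
  have dir: "gunion \<Theta> \<Theta>' \<in> R" if "\<Theta> \<in> R" "\<Theta>' \<in> R" for \<Theta> \<Theta>'
  proof -
    \<comment> \<open>First \<open>\<Theta>'\<close> is replaced by \<open>\<Gamma>\<close>, then
      \<open>\<Theta>\<close> by \<open>\<Gamma>\<close>, which leaves the union of
      \<open>\<Gamma>\<close> with itself.\<close>
    have "((gunion \<Theta> \<Theta>', g), (gunion \<Theta> \<Gamma>, g)) \<in> xiG"
      using that RM by (intro xi_gunion) (simp_all add: R_def)
    moreover have "((gunion \<Gamma> \<Theta>, g), (gunion \<Gamma> \<Gamma>, g)) \<in> xiG"
      using that \<Gamma> by (intro xi_gunion) (simp_all add: R_def)
    ultimately show ?thesis
      using xi_trans by (simp add: R_def gunion_absorb[OF gle_refl] gunion_commute[of \<Gamma> \<Theta>])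
  qed
  have "subgraph G X \<iota> U"
    using Rs unfolding subgraph_def U_def by (simp, blast)
  moreover have "set es \<subseteq> edges U"
    if e: "e \<in> edges U" and es: "simple_cycle G X \<iota> es" "e \<in> set es" for e es
  proof -
    obtain \<Theta> where \<Theta>: "\<Theta> \<in> R" "e \<in> edges \<Theta>" using e by (auto simp: U_def)
    obtain \<Theta>' where \<Theta>': "((\<Theta>', g), (\<Theta>, g)) \<in> xiG" "set es \<subseteq> edges \<Theta>'"
      using xi_add_cycle[OF RM[OF \<Theta>(1)] \<Theta>(2) es] by blast
    then have "\<Theta>' \<in> R" using \<Theta>(1) xi_trans by (auto simp: R_def)
    then show ?thesis using \<Theta>'(2) by (auto simp: U_def)
  qed
  ultimately have "cyclic_subgraph G X \<iota> U"
    unfolding cyclic_subgraph_def by blast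
  moreover have "gle \<Gamma> U" using \<Gamma>R by (auto simp: gle_def U_def)
  ultimately have "gle (clo \<Gamma>) U" using clo_least[OF \<Gamma>'(1)] by blast
  with le have \<Delta>U: "gle \<Delta> U" by (rule gle_trans)
  have fin: "finite (verts \<Delta>)" "finite (edges \<Delta>)"
    using MM_memD(2)[OF \<Delta>] by (auto simp: finite_graph_def)
  \<comment> \<open>Vertices and edges of \<open>\<Delta>\<close> are captured separately;
    directedness then gives one graph in \<open>R\<close> containing both.\<close>
  have "\<exists>\<Theta>\<in>R. verts \<Delta> \<subseteq> verts \<Theta>"
    using \<Gamma>R \<Delta>U dir
    by (intro directed_union_finite[OF fin(1)])
      (auto simp: gle_def U_def gunion_def intro!: bexI[OF _ dir])
  then obtain \<Theta>1 where \<Theta>1: "\<Theta>1 \<in> R" "verts \<Delta> \<subseteq> verts \<Theta>1" by blast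
  have "\<exists>\<Theta>\<in>R. edges \<Delta> \<subseteq> edges \<Theta>"
    using \<Gamma>R \<Delta>U dir
    by (intro directed_union_finite[OF fin(2)])
      (auto simp: gle_def U_def gunion_def intro!: bexI[OF _ dir])
  then obtain \<Theta>2 where \<Theta>2: "\<Theta>2 \<in> R" "edges \<Delta> \<subseteq> edges \<Theta>2" by blast
  define \<Theta> where "\<Theta> = gunion \<Theta>1 \<Theta>2"
  have \<Theta>: "\<Theta> \<in> R" "gle \<Delta> \<Theta>"
    using dir[OF \<Theta>1(1) \<Theta>2(1)] \<Theta>1(2) \<Theta>2(2) by (auto simp: \<Theta>_def gle_def gunion_def)
  \<comment> \<open>Joining \<open>\<Delta>\<close> to the related graphs \<open>\<Theta>\<close>
    and \<open>\<Gamma>\<close> leaves \<open>\<Theta>\<close> unchanged, so the union with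
    \<open>\<Gamma>\<close> is related to \<open>\<Theta>\<close> and hence to
    \<open>\<Gamma>\<close>.\<close>
  then have "((gunion \<Delta> \<Theta>, g), (gunion \<Delta> \<Gamma>, g)) \<in> xiG"
    by (intro xi_gunion[OF _ \<Delta>]) (simp add: R_def)
  then have "((gunion \<Delta> \<Gamma>, g), (\<Theta>, g)) \<in> xiG"
    by (simp add: gunion_absorb[OF \<Theta>(2)] xi_sym)
  then show ?thesis
    using \<Theta>(1) xi_trans by (auto simp: R_def)
qed

text \<open>Two graphs with the same closure each lie in the closure of the other, so each of them
  is related to their union.\<close>

lemma xi_iff_proj:
  assumes "a \<in> carrier MMG" "b \<in> carrier MMG"
  shows "(a, b) \<in> xiG \<longleftrightarrow> proj a = proj b"
proof
  assume "proj a = proj b"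
  moreover obtain \<Gamma> g \<Delta> h where ab: "a = (\<Gamma>, g)" "b = (\<Delta>, h)" by (cases a, cases b)
  ultimately have h: "h = g" and clo: "clo \<Gamma> = clo \<Delta>" by (auto simp: proj_def)
  have m: "(\<Gamma>, g) \<in> carrier MMG" "(\<Delta>, g) \<in> carrier MMG" using assms by (auto simp: ab h)
  have "gle \<Delta> (clo \<Gamma>)" "gle \<Gamma> (clo \<Delta>)"
    using gle_clo[OF MM_memD(1)[OF m(1)]] gle_clo[OF MM_memD(1)[OF m(2)]] by (simp_all add: clo)
  then have "((gunion \<Delta> \<Gamma>, g), (\<Gamma>, g)) \<in> xiG" "((gunion \<Delta> \<Gamma>, g), (\<Delta>, g)) \<in> xiG"
    using xi_absorb[OF m] xi_absorb[OF m(2,1)] by (simp_all add: gunion_commute[of \<Delta> \<Gamma>])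
  then show "(a, b) \<in> xiG"
    unfolding ab h by (rule xi_trans[OF xi_sym])
qed (rule xi_proj)

text \<open>The value of the induced isomorphism on a class is known only for representatives in the
  carrier; this makes it available on the generators.\<close>

lemma MM_gen_closed:
  assumes "x \<in> X"
  shows "MM_gen G \<iota> x \<in> carrier MMG"
proof -
  have "\<iota> x \<in> carrier G" using assms gens_closed by auto
  then have p: "path_in G \<iota> (Cay G X) \<one> [(\<one>, Pos x)] (\<iota> x)"
    using assms by (auto simp: Cay_def letters_def src_def tgt_def)
  show ?thesis
    using subgraph_spanned[OF p] connected_graph_spanned[OF p]
      path_in_start[OF path_in_spanned[OF p]] path_in_end[OF path_in_spanned[OF p]]
    by (simp add: MM_gen_def gen_graph_def MM_mem finite_graph_spanned)
qed

end

section \<open>The isomorphism and its values on the generators\<close>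

theorem proposition3p4:
  fixes G :: "('g, 'm) monoid_scheme" and X :: "'x set" and \<iota> :: "'x \<Rightarrow> 'g"
  assumes "X_generated_group G X \<iota>"
  shows "\<exists>\<phi>. \<phi> \<in> inv_monoid_iso (M_sF G X \<iota>) (S_circ G X \<iota>) \<and>
             (\<forall>x\<in>X. \<phi> (M_sF_gen G X \<iota> x) = S_circ_gen G X \<iota> x)"
proof -
  interpret X_generated_group G X \<iota> by (rule assms)
  obtain \<phi> where \<phi>: "\<phi> \<in> inv_monoid_iso (M_sF G X \<iota>) (S_circ G X \<iota>)"
    "\<And>a. a \<in> carrier (MM G X \<iota>) \<Longrightarrow> \<phi> (xi G X \<iota> `` {a}) = proj a"
    using quotient_monoid_iso[OF xi_congruence MM_one_closed MM_mult_closed MM_minv_closed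
        proj_mult proj_one proj_minv proj_surj xi_iff_proj]
    unfolding M_sF_def by blast
  have "\<phi> (M_sF_gen G X \<iota> x) = S_circ_gen G X \<iota> x" if "x \<in> X" for x
    using \<phi>(2)[OF MM_gen_closed[OF that]]
    by (simp add: M_sF_gen_def MM_gen_def S_circ_gen_def proj_def)
  with \<phi>(1) show ?thesis by blast
qed

end
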